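(* If $G$ is a finite connected bipartite planar graph, then $\mathrm{cc}(G)\le 4$. Furthermore, there exists a bipartite planar graph $H$ with $\mathrm{cc}(H)=4$.
   Context: All graphs are finite, connected and reflexive (a loop at every vertex; moving along a loop means passing); loops are ignored for planarity and bipartiteness. Cops and Attacking Robbers: the cop player places $k$ cops on vertices, then the robber chooses a vertex. In each round the cops move (each cop moves to an adjacent vertex or passes), then the robber moves (to an adjacent vertex or passes). The cops win if after finitely many moves a cop moves onto the robber's vertex. Additionally, if the robber moves onto a vertex occupied by a cop, exactly one cop on that vertex is removed from the game; the robber's initial placement on a cop's vertex does not count as an attack. Both players play optimally. The attacking cop number $\mathrm{cc}(G)$ is the least $k$ such that $k$ cops can guarantee a win. *)

theory Defs
  imports "HOL-Analysis.Analysis"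
begin

text \<open>A finite simple graph on vertex set V with symmetric irreflexive edge relation E.
  Loops (reflexivity) are modelled implicitly: every player may pass.\<close>

definition graph :: "'a set \<Rightarrow> ('a \<Rightarrow> 'a \<Rightarrow> bool) \<Rightarrow> bool" where
  "graph V E \<longleftrightarrow> finite V \<and> V \<noteq> {} \<and>
     (\<forall>u v. E u v \<longrightarrow> u \<in> V \<and> v \<in> V) \<and>
     (\<forall>u v. E u v \<longrightarrow> E v u) \<and> (\<forall>u. \<not> E u u)"

definition connected_graph :: "'a set \<Rightarrow> ('a \<Rightarrow> 'a \<Rightarrow> bool) \<Rightarrow> bool" where
  "connected_graph V E \<longleftrightarrow> (\<forall>u\<in>V. \<forall>v\<in>V. E\<^sup>*\<^sup>* u v)"

definition bipartite :: "'a set \<Rightarrow> ('a \<Rightarrow> 'a \<Rightarrow> bool) \<Rightarrow> bool" where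
  "bipartite V E \<longleftrightarrow> (\<exists>A\<subseteq>V. \<forall>u v. E u v \<longrightarrow> (u \<in> A \<longleftrightarrow> v \<notin> A))"

definition planar :: "'a set \<Rightarrow> ('a \<Rightarrow> 'a \<Rightarrow> bool) \<Rightarrow> bool" where
  "planar V E \<longleftrightarrow> (\<exists>(f :: 'a \<Rightarrow> complex) (g :: 'a set \<Rightarrow> real \<Rightarrow> complex).
     inj_on f V \<and>
     (\<forall>u v. E u v \<longrightarrow> arc (g {u, v}) \<and>
        {pathstart (g {u, v}), pathfinish (g {u, v})} = {f u, f v} \<and>
        (\<forall>w\<in>V - {u, v}. f w \<notin> path_image (g {u, v}))) \<and>
     (\<forall>u v x y. E u v \<longrightarrow> E x y \<longrightarrow> {u, v} \<noteq> {x, y} \<longrightarrow>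
        path_image (g {u, v}) \<inter> path_image (g {x, y}) \<subseteq> f ` ({u, v} \<inter> {x, y})))"

definition nstep :: "('a \<Rightarrow> 'a \<Rightarrow> bool) \<Rightarrow> 'a \<Rightarrow> 'a \<Rightarrow> bool" where
  "nstep E u v \<longleftrightarrow> u = v \<or> E u v"

text \<open>cwin E cs r: positions cs of the remaining cops (a list, one entry per cop) and
  robber position r, with the cops to move; the cops can force a capture in finitely
  many moves. After the cops move to cs', they win if some cop is on r. Otherwise the
  robber moves to r'; if r' is occupied by a cop, exactly one cop on r' is removed.\<close>

inductive cwin :: "('a \<Rightarrow> 'a \<Rightarrow> bool) \<Rightarrow> 'a list \<Rightarrow> 'a \<Rightarrow> bool" for E where
  "list_all2 (nstep E) cs cs' \<Longrightarrow>
   (r \<in> set cs' \<or>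
    (\<forall>r'. nstep E r r' \<longrightarrow> cwin E (if r' \<in> set cs' then remove1 r' cs' else cs') r'))
   \<Longrightarrow> cwin E cs r"

definition cops_win :: "'a set \<Rightarrow> ('a \<Rightarrow> 'a \<Rightarrow> bool) \<Rightarrow> nat \<Rightarrow> bool" where
  "cops_win V E k \<longleftrightarrow> (\<exists>cs. length cs = k \<and> set cs \<subseteq> V \<and> (\<forall>r\<in>V. cwin E cs r))"

definition attacking_cop_number :: "'a set \<Rightarrow> ('a \<Rightarrow> 'a \<Rightarrow> bool) \<Rightarrow> nat" where
  "attacking_cop_number V E = (LEAST k. cops_win V E k)"

end

theory Submission
  imports Defs
begin

text \<open>
  Upper bound. Colour the graph by its two sides. A cop who follows the image of the robber under a
  colour-preserving retraction onto a shortest path always has the robber's colour after his move,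
  hence is never adjacent to the robber and cannot be attacked, and he captures a robber who enters
  the path. Two cops on the same vertex may travel freely, since an attack on one is answered by the
  other. So the argument of Aigner and Fromme goes through: two cops keep the robber in a territory
  bounded by a cycle made of two guarded pieces, while the other two walk together to a shortest path
  through the territory and start guarding it. By planarity no component of the rest of the territory
  touches all three interiors of the resulting theta graph, which frees a cop and shrinks the territory.

  Lower bound. Subdivide every edge of the dodecahedron once. A robber on an original vertex has to
  move only if a neighbouring cop is protected by a second cop. The third cop cannot block both of the
  other two original neighbours because the dodecahedron has girth 5. An unprotected cop is attacked,
  and two cops cannot dislodge the robber from the middle of a subdivided edge.
\<close>

section \<open>Theta curves in the plane\<close>

text \<open>In the ordinary game three cops suffice on a planar graph: two guard and one moves. Here
  a lone moving cop could be attacked, so he is doubled, and this is where the fourth cop goes. The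
  guards have to work alone, and it is bipartiteness that makes them immune: every proper move
  changes the robber's colour, so he cannot step onto a cop of the colour that he leaves.

  After the territory has been split, the two free cops may stand on different vertices. They gather
  inside a connected set \<open>D\<close> disjoint from the territory \<open>R\<close>, where they
  can be attacked only by a robber who leaves \<open>R\<close> and is then captured by a guard. The
  new path need only be shortest among the paths through \<open>R\<close>, because distances through
  \<open>R\<close> are all that a robber confined to \<open>R\<close> can exploit.

  In the lower bound, a cop who protects an attacker on a subdividing vertex stands on the same
  vertex or at the far end of the same edge. In a graph without triangles both of them are then too
  far from the robber's other destinations.\<close>

lemma Jordan_two_arcs:
  fixes c1 c2 :: "real \<Rightarrow> complex"
  assumes "arc c1" "pathstart c1 = a" "pathfinish c1 = b"
    and "arc c2" "pathstart c2 = a" "pathfinish c2 = b"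
    and "path_image c1 \<inter> path_image c2 = {a, b}"
  defines "C \<equiv> path_image c1 \<union> path_image c2"
  shows "inside C \<noteq> {}" "open (inside C)" "connected (inside C)" "open (outside C)"
    "connected (outside C)" "inside C \<inter> outside C = {}" "inside C \<union> outside C = - C"
    "closure (inside C) = inside C \<union> C"
proof -
  let ?c = "c1 +++ reversepath c2"
  have im: "path_image ?c = C"
    using assms by (simp add: path_image_join)
  have "simple_path ?c"
    by (rule simple_path_join_loop) (use assms arc_reversepath in auto)
  then have J: "inside C \<noteq> {} \<and> open (inside C) \<and> connected (inside C) \<and> outside C \<noteq> {} \<and>
      open (outside C) \<and> connected (outside C) \<and> bounded (inside C) \<and> \<not> bounded (outside C) \<and>
      inside C \<inter> outside C = {} \<and> inside C \<union> outside C = - C \<and>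
      frontier (inside C) = C \<and> frontier (outside C) = C"
    using Jordan_inside_outside[of ?c] assms im by simp
  then show "inside C \<noteq> {}" "open (inside C)" "connected (inside C)" "open (outside C)"
    "connected (outside C)" "inside C \<inter> outside C = {}" "inside C \<union> outside C = - C"
    by auto
  show "closure (inside C) = inside C \<union> C"
    using J closure_Un_frontier by metis
qed

lemma connected_subset_open_Un:
  assumes "connected Z" "open A" "open B" "A \<inter> B = {}" "Z \<subseteq> A \<union> B" "z \<in> Z" "z \<in> A"
  shows "Z \<subseteq> A"
  using connectedD[OF assms(1-3)] assms(4-7) by blast

locale theta_curve =
  fixes c1 c2 c3 :: "real \<Rightarrow> complex" and a b
  assumes c1: "arc c1" "pathstart c1 = a" "pathfinish c1 = b"
    and c2: "arc c2" "pathstart c2 = a" "pathfinish c2 = b"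
    and c3: "arc c3" "pathstart c3 = a" "pathfinish c3 = b"
    and c12: "path_image c1 \<inter> path_image c2 = {a, b}"
    and c13: "path_image c1 \<inter> path_image c3 = {a, b}"
    and c23: "path_image c2 \<inter> path_image c3 = {a, b}"

text \<open>If \<open>c3\<close> ran inside the cycle of \<open>c1\<close> and \<open>c2\<close>, it
  would cut that inside into two faces. The accumulation point on \<open>c3\<close> forces
  \<open>Z\<close> into the inside, hence into one of the two faces, whose closure misses the
  interior of \<open>c1\<close> or that of \<open>c2\<close>.\<close>

lemma theta_middle_arc:
  assumes "theta_curve c1 c2 c3 a b"
    and Z: "connected Z" "Z \<inter> (path_image c1 \<union> path_image c2 \<union> path_image c3) = {}"
    and p1: "p1 \<in> path_image c1 - {a, b}" "p1 \<in> closure Z"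
    and p2: "p2 \<in> path_image c2 - {a, b}" "p2 \<in> closure Z"
    and p3: "p3 \<in> path_image c3 - {a, b}" "p3 \<in> closure Z"
  shows "path_image c3 \<inter> inside (path_image c1 \<union> path_image c2) = {}"
proof (rule ccontr)
  interpret theta_curve c1 c2 c3 a b by fact
  let ?C1 = "path_image c1" and ?C2 = "path_image c2" and ?C3 = "path_image c3"
  assume ne: "\<not> ?thesis"
  have ab: "a \<noteq> b" using c1 arc_distinct_ends by blast
  obtain dis: "inside (?C1 \<union> ?C3) \<inter> inside (?C2 \<union> ?C3) = {}"
    and un: "inside (?C1 \<union> ?C3) \<union> inside (?C2 \<union> ?C3) \<union> (?C3 - {a, b}) = inside (?C1 \<union> ?C2)"
    using split_inside_simple_closed_curve[of c1 a b c2 c3] c1 c2 c3 c12 c13 c23 ab ne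
      arc_imp_simple_path by metis
  note J12 = Jordan_two_arcs[OF c1 c2 c12] and J13 = Jordan_two_arcs[OF c1 c3 c13]
    and J23 = Jordan_two_arcs[OF c2 c3 c23]
  have "p3 \<in> inside (?C1 \<union> ?C2)" using un p3 by blast
  then obtain z where z: "z \<in> Z" "z \<in> inside (?C1 \<union> ?C2)"
    using p3(2) J12(2) by (meson closure_iff_nhds_not_empty[THEN iffD1] disjoint_iff open_Int_closure_eq_empty)
  have "Z \<subseteq> inside (?C1 \<union> ?C2)"
    using connected_subset_open_Un[OF Z(1) J12(2) J12(4) J12(6) _ z] J12(7) Z(2) by blast
  then have sub: "Z \<subseteq> inside (?C1 \<union> ?C3) \<union> inside (?C2 \<union> ?C3)"
    using un Z(2) by blast
  show False
  proof (cases "z \<in> inside (?C1 \<union> ?C3)")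
    case True
    then have "Z \<subseteq> inside (?C1 \<union> ?C3)"
      using connected_subset_open_Un[OF Z(1) J13(2) J23(2) dis sub z(1)] by blast
    then have "p2 \<in> inside (?C1 \<union> ?C3) \<union> (?C1 \<union> ?C3)"
      using p2(2) closure_mono J13(8) by blast
    then have "p2 \<in> inside (?C1 \<union> ?C2)" using un p2(1) c12 c23 by blast
    then show False using p2(1) J12(7) by blast
  next
    case False
    then have "z \<in> inside (?C2 \<union> ?C3)" using sub z by blast
    then have "Z \<subseteq> inside (?C2 \<union> ?C3)"
      using connected_subset_open_Un[OF Z(1) J23(2) J13(2) _ _ z(1)] dis sub by blast
    then have "p1 \<in> inside (?C2 \<union> ?C3) \<union> (?C2 \<union> ?C3)"
      using p1(2) closure_mono J23(8) by blast
    then have "p1 \<in> inside (?C1 \<union> ?C2)" using un p1(1) c12 c13 by blast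
    then show False using p1(1) J12(7) by blast
  qed
qed

text \<open>By \<open>theta_middle_arc\<close> and symmetry, no arc runs inside the cycle of the
  other two. Then \<open>Z\<close> is outside all three cycles, and a point \<open>q\<close> inside
  the cycle of \<open>c1\<close> and \<open>c2\<close> is outside both cycles through
  \<open>c3\<close>. These two meet in a connected set, so by Janiszewski's theorem their union does
  not separate \<open>q\<close> from \<open>Z\<close>; yet the cycle of \<open>c1\<close> and
  \<open>c2\<close> does.\<close>

lemma theta_curve_no_common_face:
  assumes "theta_curve c1 c2 c3 a b"
    and Z: "connected Z" "Z \<inter> (path_image c1 \<union> path_image c2 \<union> path_image c3) = {}"
    and p1: "p1 \<in> path_image c1 - {a, b}" "p1 \<in> closure Z"
    and p2: "p2 \<in> path_image c2 - {a, b}" "p2 \<in> closure Z"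
    and p3: "p3 \<in> path_image c3 - {a, b}" "p3 \<in> closure Z"
  shows False
proof -
  interpret theta_curve c1 c2 c3 a b by fact
  let ?C1 = "path_image c1" and ?C2 = "path_image c2" and ?C3 = "path_image c3"
  have out3: "?C3 \<inter> inside (?C1 \<union> ?C2) = {}"
    by (rule theta_middle_arc[OF assms(1) Z p1 p2 p3])
  have "theta_curve c1 c3 c2 a b"
    by unfold_locales (use c1 c2 c3 c12 c13 c23 in auto)
  then have out2: "?C2 \<inter> inside (?C1 \<union> ?C3) = {}"
    using theta_middle_arc[OF _ Z(1) _ p1 p3 p2] Z(2) by blast
  have "theta_curve c2 c3 c1 a b"
    by unfold_locales (use c1 c2 c3 c12 c13 c23 in auto)
  then have out1: "?C1 \<inter> inside (?C2 \<union> ?C3) = {}"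
    using theta_middle_arc[OF _ Z(1) _ p2 p3 p1] Z(2) by blast
  note J12 = Jordan_two_arcs[OF c1 c2 c12] and J13 = Jordan_two_arcs[OF c1 c3 c13]
    and J23 = Jordan_two_arcs[OF c2 c3 c23]
  obtain q where q: "q \<in> inside (?C1 \<union> ?C2)" using J12(1) by blast
  obtain z where z: "z \<in> Z" using p1(2) by fastforce
  have z12: "z \<in> outside (?C1 \<union> ?C2)"
  proof (rule ccontr)
    assume "z \<notin> outside (?C1 \<union> ?C2)"
    then have "z \<in> inside (?C1 \<union> ?C2)" using J12(7) Z(2) z by blast
    then have "Z \<subseteq> inside (?C1 \<union> ?C2)"
      using connected_subset_open_Un[OF Z(1) J12(2) J12(4) J12(6) _ z] J12(7) Z(2) by blast
    then have "p3 \<in> inside (?C1 \<union> ?C2) \<union> (?C1 \<union> ?C2)"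
      using p3(2) closure_mono J12(8) by blast
    then show False using p3(1) out3 c13 c23 by blast
  qed
  have z13: "z \<in> outside (?C1 \<union> ?C3)"
  proof (rule ccontr)
    assume "z \<notin> outside (?C1 \<union> ?C3)"
    then have "z \<in> inside (?C1 \<union> ?C3)" using J13(7) Z(2) z by blast
    then have "Z \<subseteq> inside (?C1 \<union> ?C3)"
      using connected_subset_open_Un[OF Z(1) J13(2) J13(4) J13(6) _ z] J13(7) Z(2) by blast
    then have "p2 \<in> inside (?C1 \<union> ?C3) \<union> (?C1 \<union> ?C3)"
      using p2(2) closure_mono J13(8) by blast
    then show False using p2(1) out2 c12 c23 by blast
  qed
  have z23: "z \<in> outside (?C2 \<union> ?C3)"
  proof (rule ccontr)
    assume "z \<notin> outside (?C2 \<union> ?C3)"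
    then have "z \<in> inside (?C2 \<union> ?C3)" using J23(7) Z(2) z by blast
    then have "Z \<subseteq> inside (?C2 \<union> ?C3)"
      using connected_subset_open_Un[OF Z(1) J23(2) J23(4) J23(6) _ z] J23(7) Z(2) by blast
    then have "p1 \<in> inside (?C2 \<union> ?C3) \<union> (?C2 \<union> ?C3)"
      using p1(2) closure_mono J23(8) by blast
    then show False using p1(1) out1 c12 c13 by blast
  qed
  \<comment> \<open>Otherwise the whole inside of the cycle of \<open>c1\<close> and
    \<open>c2\<close>, which \<open>c3\<close> does not enter, would lie inside the cycle of
    \<open>c1\<close> and \<open>c3\<close>; taking closures puts \<open>c2\<close> inside as well,
    against \<open>out2\<close>.\<close>
  have q13: "q \<in> outside (?C1 \<union> ?C3)"
  proof (rule ccontr)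
    have sub: "inside (?C1 \<union> ?C2) \<subseteq> inside (?C1 \<union> ?C3) \<union> outside (?C1 \<union> ?C3)"
      using J13(7) J12(7) out3 by blast
    assume "q \<notin> outside (?C1 \<union> ?C3)"
    then have "q \<in> inside (?C1 \<union> ?C3)" using sub q by blast
    then have "inside (?C1 \<union> ?C2) \<subseteq> inside (?C1 \<union> ?C3)"
      using connected_subset_open_Un[OF J12(3) J13(2) J13(4) J13(6) sub q] by blast
    then have "inside (?C1 \<union> ?C2) \<union> (?C1 \<union> ?C2) \<subseteq> inside (?C1 \<union> ?C3) \<union> (?C1 \<union> ?C3)"
      using closure_mono J12(8) J13(8) by metis
    then show False using p2(1) out2 c12 c23 by blast
  qed
  have q23: "q \<in> outside (?C2 \<union> ?C3)"
  proof (rule ccontr)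
    have sub: "inside (?C1 \<union> ?C2) \<subseteq> inside (?C2 \<union> ?C3) \<union> outside (?C2 \<union> ?C3)"
      using J23(7) J12(7) out3 by blast
    assume "q \<notin> outside (?C2 \<union> ?C3)"
    then have "q \<in> inside (?C2 \<union> ?C3)" using sub q by blast
    then have "inside (?C1 \<union> ?C2) \<subseteq> inside (?C2 \<union> ?C3)"
      using connected_subset_open_Un[OF J12(3) J23(2) J23(4) J23(6) sub q] by blast
    then have "inside (?C1 \<union> ?C2) \<union> (?C1 \<union> ?C2) \<subseteq> inside (?C2 \<union> ?C3) \<union> (?C2 \<union> ?C3)"
      using closure_mono J12(8) J23(8) by metis
    then show False using p1(1) out1 c12 c13 by blast
  qed
  have "connected_component (- ((?C1 \<union> ?C3) \<union> (?C2 \<union> ?C3))) q z"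
  proof (rule Janiszewski)
    show "compact (?C1 \<union> ?C3)" "closed (?C2 \<union> ?C3)"
      using c1 c2 c3 by (auto intro!: compact_Un closed_Un closed_path_image compact_path_image arc_imp_path)
    have "(?C1 \<union> ?C3) \<inter> (?C2 \<union> ?C3) = ?C3" using c12 c13 by blast
    then show "connected ((?C1 \<union> ?C3) \<inter> (?C2 \<union> ?C3))"
      using c3 by (simp add: connected_arc_image)
    show "connected_component (- (?C1 \<union> ?C3)) q z"
      unfolding connected_component_def using J13(5,7) q13 z13 by blast
    show "connected_component (- (?C2 \<union> ?C3)) q z"
      unfolding connected_component_def using J23(5,7) q23 z23 by blast
  qed
  then obtain T where T: "connected T" "T \<subseteq> - (?C1 \<union> ?C2)" "q \<in> T" "z \<in> T"
    unfolding connected_component_def by blast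
  then have "T \<subseteq> inside (?C1 \<union> ?C2)"
    using connected_subset_open_Un[OF T(1) J12(2) J12(4) J12(6) _ T(3) q] J12(7) by blast
  then show False using T(4) z12 J12(6) by blast
qed

section \<open>Theta graphs in plane drawings\<close>

definition conn_on :: "('a \<Rightarrow> 'a \<Rightarrow> bool) \<Rightarrow> 'a set \<Rightarrow> bool" where
  "conn_on E D \<longleftrightarrow> (\<forall>u\<in>D. \<forall>v\<in>D. (\<lambda>a b. E a b \<and> a \<in> D \<and> b \<in> D)\<^sup>*\<^sup>* u v)"

fun path_edges :: "'a list \<Rightarrow> 'a set set" where
  "path_edges (u # v # p) = insert {u, v} (path_edges (v # p))"
| "path_edges _ = {}"

lemma path_edgesD:
  "e \<in> path_edges p \<Longrightarrow> successively E p \<Longrightarrow> \<exists>u v. E u v \<and> e = {u, v} \<and> u \<in> set p \<and> v \<in> set p"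
  by (induction p rule: path_edges.induct) auto

lemma path_edges_subset: "e \<in> path_edges p \<Longrightarrow> e \<subseteq> set p"
  by (induction p rule: path_edges.induct) auto

text \<open>Two paths that share only their ends could have just one edge in common, the one joining
  the ends. This rules it out for paths with three or more vertices.\<close>

lemma path_edges_ends:
  assumes "distinct p" "{hd p, last p} \<in> path_edges p"
  shows "length p \<le> 2"
proof (cases p rule: path_edges.cases)
  case (1 u v r)
  have "u \<notin> set (v # r)" using assms 1 by auto
  then have "{u, last p} \<notin> path_edges (v # r)"
    using path_edges_subset[of "{u, last p}" "v # r"] by auto
  then have "{u, last p} = {u, v}" using assms(2) 1 by auto
  then have "last (v # r) = v" using 1 by (auto simp: doubleton_eq_iff)
  then have "r = []" using assms(1) 1 by (cases r) (auto split: if_splits)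
  then show ?thesis using 1 by simp
qed auto

lemma mem_path_edges: "v \<in> set p \<Longrightarrow> 2 \<le> length p \<Longrightarrow> \<exists>e\<in>path_edges p. v \<in> e"
proof (induction p rule: path_edges.induct)
  case (1 u w p)
  then show ?case by (cases p) auto
qed auto

lemma connected_arc_image_minus_finish:
  fixes c :: "real \<Rightarrow> 'a::t2_space"
  assumes "arc c"
  shows "connected (path_image c - {pathfinish c})"
    and "pathfinish c \<in> closure (path_image c - {pathfinish c})"
proof -
  have inj: "inj_on c {0..1}" and cont: "continuous_on {0..1} c"
    using assms by (auto simp: arc_def path_def)
  have "{0..1} - {1} = {0..<1::real}" "{0..<1} \<subseteq> {0..1::real}" by auto
  then have eq: "path_image c - {pathfinish c} = c ` {0..<1}"
    using inj_on_image_set_diff[OF inj, of "{0..1}" "{1}"] by (simp add: path_image_def pathfinish_def)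
  show "connected (path_image c - {pathfinish c})"
    unfolding eq by (rule connected_continuous_image) (auto intro: continuous_on_subset[OF cont])
  have "c ` closure {0..<1} \<subseteq> closure (c ` {0..<1})"
    using cont by (intro image_closure_subset) (auto intro: subsetD[OF closure_subset])
  then show "pathfinish c \<in> closure (path_image c - {pathfinish c})"
    unfolding eq by (auto simp: pathfinish_def)
qed

locale plane_drawing =
  fixes V :: "'a set" and E :: "'a \<Rightarrow> 'a \<Rightarrow> bool" and f :: "'a \<Rightarrow> complex"
    and g :: "'a set \<Rightarrow> real \<Rightarrow> complex"
  assumes graph: "graph V E" and inj: "inj_on f V"
    and edge_arc: "E u v \<Longrightarrow> arc (g {u, v})"
    and edge_ends: "E u v \<Longrightarrow> {pathstart (g {u, v}), pathfinish (g {u, v})} = {f u, f v}"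
    and edge_vertex: "E u v \<Longrightarrow> w \<in> V \<Longrightarrow> w \<notin> {u, v} \<Longrightarrow> f w \<notin> path_image (g {u, v})"
    and edge_edge: "E u v \<Longrightarrow> E x y \<Longrightarrow> {u, v} \<noteq> {x, y} \<Longrightarrow>
        path_image (g {u, v}) \<inter> path_image (g {x, y}) \<subseteq> f ` ({u, v} \<inter> {x, y})"
begin

lemma edge_V: "E u v \<Longrightarrow> u \<in> V" "E u v \<Longrightarrow> v \<in> V"
  using graph unfolding graph_def by auto

lemma oriented_edge:
  assumes "E u v"
  obtains c where "arc c" "pathstart c = f u" "pathfinish c = f v" "path_image c = path_image (g {u, v})"
proof (cases "pathstart (g {u, v}) = f u")
  case True
  then have "pathfinish (g {u, v}) = f v" using edge_ends[OF assms] by (auto simp: doubleton_eq_iff)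
  then show ?thesis using that[of "g {u, v}"] True edge_arc[OF assms] by simp
next
  case False
  then have "pathfinish (g {u, v}) = f u" "pathstart (g {u, v}) = f v"
    using edge_ends[OF assms] by (auto simp: doubleton_eq_iff)
  then show ?thesis using that[of "reversepath (g {u, v})"] arc_reversepath[OF edge_arc[OF assms]] by simp
qed

lemma ends_on_edge: "E u v \<Longrightarrow> f u \<in> path_image (g {u, v})" "E u v \<Longrightarrow> f v \<in> path_image (g {u, v})"
  using oriented_edge[of u v] pathstart_in_path_image pathfinish_in_path_image by metis+

definition draw :: "'a list \<Rightarrow> complex set" where
  "draw p = (\<Union>e\<in>path_edges p. path_image (g e))"

lemma path_drawing_arc:
  assumes "successively E p" "distinct p" "2 \<le> length p"
  shows "\<exists>c. arc c \<and> pathstart c = f (hd p) \<and> pathfinish c = f (last p) \<and> path_image c = draw p"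
  using assms
proof (induction p rule: path_edges.induct)
  case (1 u v r)
  have uv: "E u v" using 1(2) by simp
  obtain c1 where c1: "arc c1" "pathstart c1 = f u" "pathfinish c1 = f v" "path_image c1 = path_image (g {u, v})"
    using oriented_edge[OF uv] by blast
  show ?case
  proof (cases "r = []")
    case True
    then show ?thesis using c1 by (auto simp: draw_def)
  next
    case False
    have suc: "successively E (v # r)" using 1(2) by (cases r) auto
    then obtain c2 where c2: "arc c2" "pathstart c2 = f v" "pathfinish c2 = f (last (v # r))"
      "path_image c2 = draw (v # r)"
      using 1 False by (cases r) auto
    have "path_image (g {u, v}) \<inter> path_image (g e) \<subseteq> {f v}" if e: "e \<in> path_edges (v # r)" for e
    proof -
      obtain x y where xy: "E x y" "e = {x, y}" "x \<in> set (v # r)" "y \<in> set (v # r)"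
        using path_edgesD[OF e suc] by blast
      moreover have "u \<notin> {x, y}" using xy 1(3) by auto
      ultimately show ?thesis using edge_edge[OF uv xy(1)] by blast
    qed
    then have int: "path_image c1 \<inter> path_image c2 \<subseteq> {f v}"
      unfolding c1(4) c2(4) draw_def by blast
    have "arc (c1 +++ c2)" using arc_join[OF c1(1) c2(1)] c1 c2 int by simp
    moreover have "path_image (c1 +++ c2) = draw (u # v # r)"
      using c1 c2 by (simp add: path_image_join draw_def)
    ultimately show ?thesis using c1 c2 False by (intro exI[of _ "c1 +++ c2"]) simp
  qed
qed auto

lemma draw_Int:
  assumes p: "successively E p" "distinct p" "3 \<le> length p" "hd p = x" "last p = y"
    and q: "successively E q" and pq: "set p \<inter> set q = {x, y}"
  shows "draw p \<inter> draw q \<subseteq> {f x, f y}"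
proof -
  have "path_image (g e) \<inter> path_image (g e') \<subseteq> {f x, f y}"
    if e: "e \<in> path_edges p" "e' \<in> path_edges q" for e e'
  proof -
    obtain u v where uv: "E u v" "e = {u, v}" "u \<in> set p" "v \<in> set p"
      using path_edgesD[OF e(1) p(1)] by blast
    obtain u' v' where uv': "E u' v'" "e' = {u', v'}" "u' \<in> set q" "v' \<in> set q"
      using path_edgesD[OF e(2) q] by blast
    have "e \<noteq> e'"
    proof
      assume "e = e'"
      then have "e \<subseteq> set p \<inter> set q" using path_edges_subset[OF e(1)] path_edges_subset[OF e(2)] by simp
      then have "{u, v} \<subseteq> {x, y}" using uv(2) pq by simp
      moreover have "u \<noteq> v" using uv(1) graph unfolding graph_def by auto
      ultimately have "e = {x, y}" using uv by blast
      then show False using path_edges_ends[of p] p e by simp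
    qed
    then have "path_image (g e) \<inter> path_image (g e') \<subseteq> f ` ({u, v} \<inter> {u', v'})"
      using edge_edge[OF uv(1) uv'(1)] uv(2) uv'(2) by simp
    moreover have "{u, v} \<inter> {u', v'} \<subseteq> {x, y}" using uv(3,4) uv'(3,4) pq by auto
    ultimately show ?thesis by blast
  qed
  then show ?thesis unfolding draw_def by blast
qed

lemma vertex_draw: "v \<in> set p \<Longrightarrow> 2 \<le> length p \<Longrightarrow> successively E p \<Longrightarrow> f v \<in> draw p"
proof -
  assume a: "v \<in> set p" "2 \<le> length p" "successively E p"
  obtain e where e: "e \<in> path_edges p" "v \<in> e" using mem_path_edges[OF a(1,2)] by blast
  then obtain x y where "E x y" "e = {x, y}" using path_edgesD[OF e(1) a(3)] by blast
  then have "f v \<in> path_image (g e)" using e(2) ends_on_edge by auto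
  then show ?thesis using e(1) unfolding draw_def by blast
qed

section \<open>Connected vertex sets as connected plane sets\<close>

text \<open>Edges leaving \<open>K\<close> are kept without their outer end. The set then avoids
  every path outside \<open>K\<close>, while the outer ends stay in its closure: it is the connected
  set \<open>Z\<close> of the theta curve lemma.\<close>

definition star :: "'a set \<Rightarrow> complex set" where
  "star K = f ` K \<union> (\<Union>{path_image (g {u, v}) |u v. u \<in> K \<and> v \<in> K \<and> E u v}) \<union>
    (\<Union>{path_image (g {u, s}) - {f s} |u s. u \<in> K \<and> s \<notin> K \<and> E u s})"

lemma connected_component_star:
  assumes "A \<subseteq> star K" "connected A" "x \<in> A" "y \<in> A"
  shows "connected_component (star K) x y"
  using assms unfolding connected_component_def by blast

lemma connected_half_edge:
  assumes "E u s"
  shows "connected (path_image (g {u, s}) - {f s})" "f s \<in> closure (path_image (g {u, s}) - {f s})"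
proof -
  obtain c where c: "arc c" "pathstart c = f u" "pathfinish c = f s" "path_image c = path_image (g {u, s})"
    using oriented_edge[OF assms] by blast
  show "connected (path_image (g {u, s}) - {f s})" "f s \<in> closure (path_image (g {u, s}) - {f s})"
    using connected_arc_image_minus_finish[OF c(1)] c by simp_all
qed

lemma connected_star:
  assumes K: "K \<subseteq> V" "conn_on E K"
  shows "connected (star K)"
proof (cases "K = {}")
  case True
  then show ?thesis by (simp add: star_def)
next
  case False
  then obtain k0 where k0: "k0 \<in> K" by blast
  have edge: "connected_component (star K) (f u) z"
    if "u \<in> K" "v \<in> K" "E u v" "z \<in> path_image (g {u, v})" for u v z
  proof (rule connected_component_star)
    show "path_image (g {u, v}) \<subseteq> star K" unfolding star_def using that by blast
    show "connected (path_image (g {u, v}))" using edge_arc[OF that(3)] by (simp add: connected_arc_image)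
  qed (use that ends_on_edge in auto)
  have vert: "connected_component (star K) (f k0) (f v)" if v: "v \<in> K" for v
  proof -
    have "(\<lambda>a b. E a b \<and> a \<in> K \<and> b \<in> K)\<^sup>*\<^sup>* k0 v" using K(2) k0 v unfolding conn_on_def by blast
    then show ?thesis
    proof induction
      case base
      then show ?case using k0 by (simp add: connected_component_refl star_def)
    next
      case (step a b)
      then have "connected_component (star K) (f a) (f b)"
        using edge[of a b "f b"] ends_on_edge by blast
      then show ?case using step connected_component_trans by blast
    qed
  qed
  have "connected_component (star K) (f k0) z" if "z \<in> star K" for z
  proof -
    consider "z \<in> f ` K" | u v where "u \<in> K" "v \<in> K" "E u v" "z \<in> path_image (g {u, v})"
      | u s where "u \<in> K" "s \<notin> K" "E u s" "z \<in> path_image (g {u, s}) - {f s}"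
      using \<open>z \<in> star K\<close> unfolding star_def by blast
    then show ?thesis
    proof cases
      case 1
      then show ?thesis using vert by blast
    next
      case 2
      then show ?thesis using vert edge connected_component_trans by metis
    next
      case 3
      have "u \<noteq> s" using 3 by blast
      then have "f u \<noteq> f s" using inj edge_V[OF 3(3)] by (meson inj_onD)
      then have "f u \<in> path_image (g {u, s}) - {f s}" using ends_on_edge[OF 3(3)] by simp
      moreover have "path_image (g {u, s}) - {f s} \<subseteq> star K" unfolding star_def using 3 by blast
      ultimately have "connected_component (star K) (f u) z"
        using connected_component_star connected_half_edge(1)[OF 3(3)] 3(4) by blast
      then show ?thesis using vert[OF 3(1)] connected_component_trans by metis
    qed
  qed
  then show ?thesis
    unfolding connected_iff_connected_component
    using connected_component_sym connected_component_trans by metis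
qed

lemma star_draw_disjoint:
  assumes K: "K \<subseteq> V" and p: "successively E p" "set p \<inter> K = {}"
  shows "star K \<inter> draw p = {}"
proof -
  have False if z: "z \<in> star K" "e \<in> path_edges p" "z \<in> path_image (g e)" for z e
  proof -
    obtain x y where xy: "E x y" "e = {x, y}" "x \<in> set p" "y \<in> set p"
      using path_edgesD[OF z(2) p(1)] by blast
    consider k where "k \<in> K" "z = f k" | u v where "u \<in> K" "v \<in> K" "E u v" "z \<in> path_image (g {u, v})"
      | u s where "u \<in> K" "s \<notin> K" "E u s" "z \<in> path_image (g {u, s}) - {f s}"
      using \<open>z \<in> star K\<close> unfolding star_def by blast
    then show False
    proof cases
      case 1
      then have "k \<notin> {x, y}" using p(2) xy by blast
      then show False using edge_vertex[OF xy(1)] z(3) 1 K xy(2) by auto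
    next
      case 2
      then have "u \<noteq> x \<and> u \<noteq> y \<and> v \<noteq> x \<and> v \<noteq> y" using p(2) xy(3,4) by auto
      then have "{u, v} \<noteq> {x, y}" "{u, v} \<inter> {x, y} = {}" by (auto simp: doubleton_eq_iff)
      then show False using edge_edge[OF 2(3) xy(1)] 2(4) z(3) xy(2) by auto
    next
      case 3
      then have "u \<notin> {x, y}" using p(2) xy by blast
      then have "{u, s} \<noteq> {x, y}" and sub: "{u, s} \<inter> {x, y} \<subseteq> {s}" by auto
      then have "z \<in> f ` ({u, s} \<inter> {x, y})" using edge_edge[OF 3(3) xy(1)] 3(4) z(3) xy(2) by auto
      then show False using sub 3(4) by auto
    qed
  qed
  then show ?thesis unfolding draw_def by blast
qed

lemma star_contact:
  assumes "E k s" "k \<in> K" "s \<notin> K"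
  shows "f s \<in> closure (star K)"
proof -
  have "path_image (g {k, s}) - {f s} \<subseteq> star K" unfolding star_def using assms by blast
  then show ?thesis using connected_half_edge(2)[OF assms(1)] closure_mono by blast
qed

end

lemma length_ge_3_if_interior:
  assumes "s \<in> set p - {hd p, last p}"
  shows "3 \<le> length p"
proof (cases p rule: path_edges.cases)
  case (1 u v r)
  then show ?thesis using assms by (cases r) auto
qed (use assms in auto)

text \<open>The graph form of \<open>K\<^sub>3\<^sub>,\<^sub>3\<close> being nonplanar, with the two ends and the connected set \<open>K\<close> on one
  side and the three path interiors on the other.\<close>

theorem planar_no_theta_contact:
  assumes "graph V E" "planar V E"
    and ps: "\<And>p. p \<in> {p1, p2, p3} \<Longrightarrow> successively E p \<and> distinct p \<and> hd p = x \<and> last p = y \<and>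
        set p \<inter> K = {} \<and> (\<exists>s\<in>set p - {x, y}. \<exists>k\<in>K. E k s)"
    and int: "set p1 \<inter> set p2 = {x, y}" "set p1 \<inter> set p3 = {x, y}" "set p2 \<inter> set p3 = {x, y}"
    and K: "K \<subseteq> V" "conn_on E K"
  shows False
proof -
  obtain f :: "'a \<Rightarrow> complex" and g :: "'a set \<Rightarrow> real \<Rightarrow> complex" where fg: "inj_on f V"
     "\<forall>u v. E u v \<longrightarrow> arc (g {u, v}) \<and>
        {pathstart (g {u, v}), pathfinish (g {u, v})} = {f u, f v} \<and>
        (\<forall>w\<in>V - {u, v}. f w \<notin> path_image (g {u, v}))"
     "\<forall>u v x y. E u v \<longrightarrow> E x y \<longrightarrow> {u, v} \<noteq> {x, y} \<longrightarrow>
        path_image (g {u, v}) \<inter> path_image (g {x, y}) \<subseteq> f ` ({u, v} \<inter> {x, y})"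
    using assms(2) unfolding planar_def by (elim exE conjE) (rule that)
  interpret plane_drawing V E f g
  proof
    fix u v x y assume "E u v" "E x y" "{u, v} \<noteq> {x, y}"
    then show "path_image (g {u, v}) \<inter> path_image (g {x, y}) \<subseteq> f ` ({u, v} \<inter> {x, y})"
      using fg(3) by simp
  qed (use fg(1,2) assms(1) in auto)
  have len: "3 \<le> length p" if "p \<in> {p1, p2, p3}" for p
    using ps[OF that] length_ge_3_if_interior[of _ p] by blast
  have "\<exists>c. arc c \<and> pathstart c = f x \<and> pathfinish c = f y \<and> path_image c = draw p"
    if "p \<in> {p1, p2, p3}" for p
    using path_drawing_arc[of p] ps[OF that] len[OF that] by auto
  then obtain c1 c2 c3 where
    c1: "arc c1" "pathstart c1 = f x" "pathfinish c1 = f y" "path_image c1 = draw p1" and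
    c2: "arc c2" "pathstart c2 = f x" "pathfinish c2 = f y" "path_image c2 = draw p2" and
    c3: "arc c3" "pathstart c3 = f x" "pathfinish c3 = f y" "path_image c3 = draw p3"
    by (metis insertCI)
  have ends: "{f x, f y} \<subseteq> draw p" if "p \<in> {p1, p2, p3}" for p
  proof -
    have "p \<noteq> []" using len[OF that] by auto
    then have "x \<in> set p" "y \<in> set p" using ps[OF that] by auto
    then show ?thesis using vertex_draw[of x p] vertex_draw[of y p] ps[OF that] len[OF that] by auto
  qed
  have th: "theta_curve c1 c2 c3 (f x) (f y)"
  proof
    have D: "draw p \<inter> draw q = {f x, f y}"
      if "p \<in> {p1, p2, p3}" "q \<in> {p1, p2, p3}" "set p \<inter> set q = {x, y}" for p q
    proof
      show "draw p \<inter> draw q \<subseteq> {f x, f y}"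
        using draw_Int[of p x y q] ps[OF that(1)] ps[OF that(2)] len[OF that(1)] that(3) by simp
    qed (use ends[OF that(1)] ends[OF that(2)] in blast)
    show "path_image c1 \<inter> path_image c2 = {f x, f y}" "path_image c1 \<inter> path_image c3 = {f x, f y}"
      "path_image c2 \<inter> path_image c3 = {f x, f y}"
      unfolding c1 c2 c3 using D int by simp_all
  qed (use c1 c2 c3 in auto)
  have contact: "\<exists>z. z \<in> draw p - {f x, f y} \<and> z \<in> closure (star K)" if p: "p \<in> {p1, p2, p3}" for p
  proof -
    obtain s k where s: "s \<in> set p - {x, y}" "k \<in> K" "E k s" using ps[OF p] by blast
    have "x \<in> V" "y \<in> V"
    proof -
      have "u \<in> V" if u: "u \<in> set p" for u
        using mem_path_edges[OF u] len[OF p] path_edgesD[of _ p E] ps[OF p] edge_V by fastforce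
      moreover have "hd p \<in> set p" "last p \<in> set p" using s by (cases p; auto)+
      ultimately show "x \<in> V" "y \<in> V" using ps[OF p] by auto
    qed
    then have "f s \<notin> {f x, f y}" using s inj edge_V[OF s(3)] by (auto dest: inj_onD)
    moreover have "f s \<in> draw p" using vertex_draw[of s p] s len[OF p] ps[OF p] by auto
    moreover have "s \<notin> K" using s ps[OF p] by blast
    ultimately show ?thesis using star_contact[OF s(3,2)] by blast
  qed
  obtain z1 z2 z3 where z: "z1 \<in> draw p1 - {f x, f y}" "z1 \<in> closure (star K)"
    "z2 \<in> draw p2 - {f x, f y}" "z2 \<in> closure (star K)" "z3 \<in> draw p3 - {f x, f y}" "z3 \<in> closure (star K)"
    using contact by (metis insertCI)
  have "star K \<inter> draw p = {}" if "p \<in> {p1, p2, p3}" for p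
    using star_draw_disjoint[OF K(1)] ps[OF that] by blast
  then have "star K \<inter> (path_image c1 \<union> path_image c2 \<union> path_image c3) = {}"
    unfolding c1 c2 c3 by blast
  then show False
    using theta_curve_no_common_face[OF th connected_star[OF K]] z unfolding c1(4) c2(4) c3(4) by blast
qed

section \<open>Guarding and chasing\<close>

text \<open>The roles of guard and free cop are tied to places in the list, and cops exchange roles
  when a guard is released.\<close>

lemma cwin_perm:
  assumes "cwin E cs r" "mset ds = mset cs"
  shows "cwin E ds r"
  using assms
proof (induction arbitrary: ds rule: cwin.induct)
  case (1 cs cs' r)
  obtain ds' where ds': "list_all2 (nstep E) ds ds'" "mset ds' = mset cs'"
    using list_all2_reorder_left_invariance[OF 1(1) 1(3)] by blast
  then have set: "set ds' = set cs'" by (metis set_mset_mset)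
  have "mset (if r' \<in> set ds' then remove1 r' ds' else ds') =
      mset (if r' \<in> set cs' then remove1 r' cs' else cs')" for r'
    using ds'(2) set by simp
  then show ?case using 1(2) ds'(1) set by (intro cwin.intros[of E ds ds' r]) blast+
qed

lemma cwin_capture:
  assumes "c \<in> set cs" "nstep E c r"
  shows "cwin E cs r"
proof (rule cwin.intros)
  show "list_all2 (nstep E) cs (map (\<lambda>x. if x = c then r else x) cs)"
    using assms(2) by (auto simp: list_all2_conv_all_nth nstep_def)
qed (use assms(1) in force)

definition nbhd :: "('a \<Rightarrow> 'a \<Rightarrow> bool) \<Rightarrow> 'a set \<Rightarrow> 'a set" where
  "nbhd E R = {s. s \<notin> R \<and> (\<exists>r\<in>R. E r s)}"

lemma conn_on_Un:
  assumes "conn_on E C" "conn_on E D" "z \<in> C" "z \<in> D"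
  shows "conn_on E (C \<union> D)"
proof -
  let ?r = "\<lambda>a b. E a b \<and> a \<in> C \<union> D \<and> b \<in> C \<union> D"
  have "?r\<^sup>*\<^sup>* u v" if "u \<in> C \<and> v \<in> C \<or> u \<in> D \<and> v \<in> D" for u v
  proof -
    have "(\<lambda>a b. E a b \<and> a \<in> C \<and> b \<in> C)\<^sup>*\<^sup>* u v \<or> (\<lambda>a b. E a b \<and> a \<in> D \<and> b \<in> D)\<^sup>*\<^sup>* u v"
      using assms(1,2) that unfolding conn_on_def by blast
    then show ?thesis by (auto elim!: rtranclp_mono[THEN predicate2D, rotated])
  qed
  then show ?thesis unfolding conn_on_def
    using assms(3,4) by (metis (no_types, lifting) Un_iff rtranclp_trans)
qed

text \<open>A cop whose position after each of his moves is the image of the robber under a shadow has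
  the robber's colour, so he cannot be attacked, and he captures as soon as the robber enters \<open>S\<close>.\<close>

definition shadow :: "'a set \<Rightarrow> ('a \<Rightarrow> 'a \<Rightarrow> bool) \<Rightarrow> 'a set \<Rightarrow> 'a set \<Rightarrow> ('a \<Rightarrow> 'a) \<Rightarrow> bool" where
  "shadow A E R S f \<longleftrightarrow> (\<forall>r\<in>R. f r \<in> A \<longleftrightarrow> r \<in> A) \<and>
    (\<forall>r\<in>R. \<forall>r'\<in>R. E r r' \<longrightarrow> E (f r) (f r')) \<and> (\<forall>r\<in>R. \<forall>s\<in>S. E r s \<longrightarrow> E (f r) s)"

text \<open>The guard's position is an index because the approach of the free pair compares places
  along the path. Index changes of exactly one carry the parity of the colouring. Path vertices
  outside \<open>R\<close>, such as the ends, are covered by the clause on neighbours.\<close>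

definition guarded_path ::
  "'a set \<Rightarrow> ('a \<Rightarrow> 'a \<Rightarrow> bool) \<Rightarrow> 'a set \<Rightarrow> 'a list \<Rightarrow> ('a \<Rightarrow> nat) \<Rightarrow> bool" where
  "guarded_path A E R p h \<longleftrightarrow> p \<noteq> [] \<and> successively E p \<and>
    (\<forall>r\<in>R. h r < length p \<and> (p ! h r \<in> A \<longleftrightarrow> r \<in> A)) \<and>
    (\<forall>r\<in>R. \<forall>r'\<in>R. E r r' \<longrightarrow> h r' = Suc (h r) \<or> h r = Suc (h r')) \<and>
    (\<forall>r\<in>R. \<forall>i<length p. E r (p ! i) \<longrightarrow> h r = Suc i \<or> i = Suc (h r)) \<and>
    (\<forall>r\<in>R \<inter> set p. p ! h r = r)"

locale two_coloured_graph =
  fixes V :: "'a set" and E :: "'a \<Rightarrow> 'a \<Rightarrow> bool" and A :: "'a set"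
  assumes graph: "graph V E" and connected: "connected_graph V E"
    and colour: "E u v \<Longrightarrow> u \<in> A \<longleftrightarrow> v \<notin> A"
begin

lemma E_sym: "E u v \<Longrightarrow> E v u"
  and E_irrefl: "\<not> E u u"
  and E_V: "E u v \<Longrightarrow> u \<in> V" "E u v \<Longrightarrow> v \<in> V"
  and finite_V: "finite V"
  using graph unfolding graph_def by auto

lemma conn_on_path: "successively E p \<Longrightarrow> conn_on E (set p)"
proof (induction p rule: path_edges.induct)
  case (1 u v p)
  have "conn_on E {u, v}"
    using 1(2) E_sym unfolding conn_on_def by (auto intro!: r_into_rtranclp)
  then show ?case
    using conn_on_Un[of E "{u, v}" "set (v # p)" v] 1 by (simp add: insert_commute)
qed (auto simp: conn_on_def)

lemma shadow_guarded_path: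
  assumes "guarded_path A E R p h"
  shows "shadow A E R (set p) (\<lambda>r. p ! h r)"
proof -
  have suc: "E (p ! i) (p ! j) \<and> E (p ! j) (p ! i)" if "i = Suc j" "i < length p" for i j
    using assms that E_sym unfolding guarded_path_def successively_conv_nth by simp
  show ?thesis
    unfolding shadow_def
  proof (intro conjI ballI impI)
    fix r assume r: "r \<in> R"
    then show "p ! h r \<in> A \<longleftrightarrow> r \<in> A" using assms unfolding guarded_path_def by blast
    fix r' assume "r' \<in> R" "E r r'"
    with r have "h r' = Suc (h r) \<or> h r = Suc (h r')" "h r < length p" "h r' < length p"
      using assms unfolding guarded_path_def by blast+
    then show "E (p ! h r) (p ! h r')" using suc by metis
  next
    fix r s assume r: "r \<in> R" "s \<in> set p" "E r s"
    then obtain i where "i < length p" "s = p ! i" by (metis in_set_conv_nth)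
    with r have "h r = Suc i \<or> i = Suc (h r)" "h r < length p" "i < length p" "s = p ! i"
      using assms unfolding guarded_path_def by blast+
    then show "E (p ! h r) s" using suc by metis
  qed
qed

lemma shadow_mono: "shadow A E R S f \<Longrightarrow> R' \<subseteq> R \<Longrightarrow> shadow A E R' S f"
  unfolding shadow_def by blast

lemma shadow_nstep:
  "shadow A E R S f \<Longrightarrow> r \<in> R \<Longrightarrow> r' \<in> R \<Longrightarrow> nstep E r r' \<Longrightarrow> nstep E (f r) (f r')"
  unfolding shadow_def nstep_def by blast

text \<open>\<open>D\<close> is where the cops stand and may regroup: it is connected and out of the robber's reach.\<close>

definition confined ::
  "'a set \<Rightarrow> 'a set \<Rightarrow> ('a \<Rightarrow> 'a) \<Rightarrow> 'a set \<Rightarrow> ('a \<Rightarrow> 'a) \<Rightarrow> 'a set \<Rightarrow> bool" where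
  "confined R S1 f1 S2 f2 D \<longleftrightarrow> R \<subseteq> V \<and> D \<subseteq> V \<and> D \<inter> R = {} \<and> conn_on E D \<and>
    shadow A E R S1 f1 \<and> shadow A E R S2 f2 \<and> f1 ` R \<subseteq> D \<and> f2 ` R \<subseteq> D \<and>
    nbhd E R \<subseteq> S1 \<union> S2"

text \<open>The cops are about to move, so a guard need only be one step from the shadow of the
  current position. This is preserved when the robber moves within the territory, and it lets a pair
  that comes this close to a new shadow supply a guard at once.\<close>

definition wins :: "('a \<Rightarrow> 'a) \<Rightarrow> ('a \<Rightarrow> 'a) \<Rightarrow> 'a set \<Rightarrow> 'a \<Rightarrow> 'a \<Rightarrow> 'a \<Rightarrow> bool" where
  "wins f1 f2 D d e r \<longleftrightarrow>
    (\<forall>c1\<in>D. \<forall>c2\<in>D. nstep E c1 (f1 r) \<longrightarrow> nstep E c2 (f2 r) \<longrightarrow> cwin E [c1, c2, d, e] r)"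

text \<open>The premise \<open>safe\<close> is the price of the attack rule: free cops move as a
  pair on one vertex, or outside the territory.\<close>

lemma wins_step:
  assumes conf: "confined R S1 f1 S2 f2 D" and r: "r \<in> R"
    and move: "nstep E d d'" "nstep E e e'" and safe: "d' = e' \<or> d' \<notin> R \<and> e' \<notin> R"
    and "next": "\<And>r'. r' \<in> R \<Longrightarrow> nstep E r r' \<Longrightarrow> wins f1 f2 D d' e' r'"
  shows "wins f1 f2 D d e r"
  unfolding wins_def
proof (intro ballI impI)
  have sh: "shadow A E R S1 f1" "shadow A E R S2 f2" and D: "f1 r \<in> D" "f2 r \<in> D"
    and N: "nbhd E R \<subseteq> S1 \<union> S2"
    using conf r unfolding confined_def by auto
  fix c1 c2 assume c: "c1 \<in> D" "c2 \<in> D" "nstep E c1 (f1 r)" "nstep E c2 (f2 r)"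
  let ?cs = "[f1 r, f2 r, d', e']"
  show "cwin E [c1, c2, d, e] r"
  proof (rule cwin.intros)
    show "list_all2 (nstep E) [c1, c2, d, e] ?cs" using c move by simp
    show "r \<in> set ?cs \<or>
      (\<forall>r'. nstep E r r' \<longrightarrow> cwin E (if r' \<in> set ?cs then remove1 r' ?cs else ?cs) r')"
    proof (subst disj_commute, intro disjCI allI impI)
      fix r' assume nr: "r \<notin> set ?cs" and r': "nstep E r r'"
      let ?ds = "if r' \<in> set ?cs then remove1 r' ?cs else ?cs"
      show "cwin E ?ds r'"
      proof (cases "r' \<in> R")
        case False
        then have "E r r'" using r r' by (auto simp: nstep_def)
        then have "r' \<in> S1 \<or> r' \<in> S2" using N False r unfolding nbhd_def by blast
        then have "E (f1 r) r' \<or> E (f2 r) r'"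
          using sh r \<open>E r r'\<close> unfolding shadow_def by blast
        then obtain c where c: "c \<in> set ?cs" "E c r'" by auto
        \<comment> \<open>The robber's move may at the same time attack another cop standing on
          \<open>r'\<close>. The guard \<open>c\<close> is elsewhere and survives.\<close>
        then have "c \<noteq> r'" using E_irrefl by blast
        then have "c \<in> set ?ds" using c(1) in_set_remove1[of c r' ?cs] by presburger
        then show ?thesis using cwin_capture c(2) unfolding nstep_def by metis
      next
        case True
        show ?thesis
        proof (cases "r' \<in> set ?cs")
          case in_cs: True
          then have "E r r'" using nr r' by (auto simp: nstep_def)
          \<comment> \<open>Guards have the colour of \<open>r\<close>, hence not that of its
            neighbour \<open>r'\<close>, so the attacked cop is a free one.\<close>
          then have "f1 r \<noteq> r'" "f2 r \<noteq> r'" using sh r colour unfolding shadow_def by metis+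
          moreover from this have "d' = r' \<or> e' = r'" using in_cs by auto
          moreover from this have "d' = r' \<and> e' = r'" using safe True by auto
          ultimately have "r' \<in> set ?ds" by auto
          then show ?thesis using cwin_capture unfolding nstep_def by metis
        next
          case False
          then show ?thesis
            using "next"[OF True r'] D shadow_nstep[OF sh(1) r True r'] shadow_nstep[OF sh(2) r True r']
            unfolding wins_def by auto
        qed
      qed
    qed
  qed
qed

lemma pair_travels:
  assumes conf: "confined R S1 f1 S2 f2 D" and walk: "E\<^sup>*\<^sup>* d d'"
    and win: "\<And>r. r \<in> R \<Longrightarrow> wins f1 f2 D d' d' r"
  shows "r \<in> R \<Longrightarrow> wins f1 f2 D d d r"
  using walk
proof (induction arbitrary: r rule: converse_rtranclp_induct)
  case base
  then show ?case using win by blast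
next
  case (step a b)
  show ?case by (rule wins_step[OF conf step(4), of a b a b]) (use step in \<open>auto simp: nstep_def\<close>)
qed

text \<open>A single cop may walk inside \<open>D\<close>: to attack him the robber must leave
  \<open>R\<close>, and then a guard captures him.\<close>

lemma free_cops_gather:
  assumes conf: "confined R S1 f1 S2 f2 D" and "d \<in> D" "e \<in> D"
    and win: "\<And>r. r \<in> R \<Longrightarrow> wins f1 f2 D e e r"
  shows "r \<in> R \<Longrightarrow> wins f1 f2 D d e r"
proof -
  have D: "D \<inter> R = {}" "conn_on E D" using conf unfolding confined_def by auto
  have "(\<lambda>a b. E a b \<and> a \<in> D \<and> b \<in> D)\<^sup>*\<^sup>* d e" using D(2) assms(2,3) unfolding conn_on_def by blast
  then show "r \<in> R \<Longrightarrow> wins f1 f2 D d e r"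
  proof (induction arbitrary: r rule: converse_rtranclp_induct)
    case base
    then show ?case using win by blast
  next
    case (step a b)
    show ?case
      by (rule wins_step[OF conf step(4), of a b e e]) (use step D(1) assms(3) in \<open>auto simp: nstep_def\<close>)
  qed
qed

text \<open>The pair starts at or below the robber's index and goes up: since his index changes
  by one per move, he can only meet it or let it come closer to the end of the path.\<close>

lemma pair_chases_shadow:
  assumes conf: "confined R S1 f1 S2 f2 D" and p: "guarded_path A E R p h"
    and win: "\<And>r c. r \<in> R \<Longrightarrow> c \<in> set p \<Longrightarrow> nstep E c (p ! h r) \<Longrightarrow> wins f1 f2 D c c r"
  shows "r \<in> R \<Longrightarrow> j \<le> h r \<Longrightarrow> wins f1 f2 D (p ! j) (p ! j) r"
proof (induction "length p - j" arbitrary: j r rule: less_induct)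
  case less
  have h: "h r < length p" using p less.prems unfolding guarded_path_def by blast
  have edge: "E (p ! j) (p ! Suc j)" if "Suc j < length p"
    using p that unfolding guarded_path_def successively_conv_nth by blast
  show ?case
  proof (cases "h r \<le> Suc j")
    case True
    then have "h r = j \<or> h r = Suc j" using less.prems by linarith
    then have "nstep E (p ! j) (p ! h r)" using edge h by (auto simp: nstep_def)
    then show ?thesis using win less.prems h by simp
  next
    \<comment> \<open>The gap is at least two, so after the pair's step forward and a robber step
      backward the pair is still at or below his index.\<close>
    case False
    show ?thesis
    proof (rule wins_step[OF conf less.prems(1)])
      show "nstep E (p ! j) (p ! Suc j)" "nstep E (p ! j) (p ! Suc j)"
        using edge False h by (auto simp: nstep_def)
      fix r' assume r': "r' \<in> R" "nstep E r r'"
      have "r' = r \<or> h r' = Suc (h r) \<or> h r = Suc (h r')"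
        using p less.prems(1) r' unfolding guarded_path_def nstep_def by blast
      then have "h r \<le> Suc (h r')" by auto
      then have "Suc j \<le> h r'" using False by linarith
      then show "wins f1 f2 D (p ! Suc j) (p ! Suc j) r'"
        using less.hyps[of "Suc j" r'] r' h False by auto
    qed simp
  qed
qed

section \<open>Winning territories and the exchange of guards\<close>

definition good :: "'a set \<Rightarrow> ('a \<Rightarrow> 'a) \<Rightarrow> ('a \<Rightarrow> 'a) \<Rightarrow> 'a set \<Rightarrow> bool" where
  "good R f1 f2 D \<longleftrightarrow> (\<forall>r\<in>R. \<forall>d\<in>D. \<forall>e\<in>D. wins f1 f2 D d e r)"

lemma good_commute: "good R f1 f2 D \<Longrightarrow> good R f2 f1 D"
  unfolding good_def wins_def
proof (intro ballI impI)
  fix r d e c1 c2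
  assume *: "\<forall>r\<in>R. \<forall>d\<in>D. \<forall>e\<in>D. \<forall>c1\<in>D. \<forall>c2\<in>D.
      nstep E c1 (f1 r) \<longrightarrow> nstep E c2 (f2 r) \<longrightarrow> cwin E [c1, c2, d, e] r"
    and "r \<in> R" "d \<in> D" "e \<in> D" "c1 \<in> D" "c2 \<in> D" "nstep E c1 (f2 r)" "nstep E c2 (f1 r)"
  then have "cwin E [c2, c1, d, e] r" by blast
  then show "cwin E [c1, c2, d, e] r" by (rule cwin_perm) simp
qed

definition component :: "'a set \<Rightarrow> 'a \<Rightarrow> 'a set" where
  "component Q r = {s. (\<lambda>a b. E a b \<and> a \<in> Q \<and> b \<in> Q)\<^sup>*\<^sup>* r s}"

lemma component:
  assumes "r \<in> Q"
  shows "r \<in> component Q r" "component Q r \<subseteq> Q" "conn_on E (component Q r)"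
    "nbhd E (component Q r) \<inter> Q = {}"
proof -
  let ?r = "\<lambda>a b. E a b \<and> a \<in> Q \<and> b \<in> Q" and ?C = "component Q r"
  show "r \<in> ?C" by (simp add: component_def)
  have sub: "s \<in> Q" if "?r\<^sup>*\<^sup>* r s" for s using that assms by induction auto
  show "?C \<subseteq> Q" unfolding component_def using sub by blast
  have sym: "symp (\<lambda>a b. E a b \<and> a \<in> ?C \<and> b \<in> ?C)" using E_sym by (auto intro: sympI)
  have from_r: "(\<lambda>a b. E a b \<and> a \<in> ?C \<and> b \<in> ?C)\<^sup>*\<^sup>* r s" if "?r\<^sup>*\<^sup>* r s" for s
    using that
  proof induction
    case (step s t)
    moreover have "s \<in> ?C" "t \<in> ?C" using step by (auto simp: component_def intro: rtranclp.rtrancl_into_rtrancl)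
    ultimately show ?case by (auto intro: rtranclp.rtrancl_into_rtrancl)
  qed simp
  show "conn_on E ?C"
    unfolding conn_on_def
  proof (intro ballI)
    fix u v assume "u \<in> ?C" "v \<in> ?C"
    then have "?r\<^sup>*\<^sup>* r u" "?r\<^sup>*\<^sup>* r v" by (auto simp: component_def)
    then show "(\<lambda>a b. E a b \<and> a \<in> ?C \<and> b \<in> ?C)\<^sup>*\<^sup>* u v"
      using rtranclp_trans[OF sympD[OF symp_rtranclp[OF sym] from_r] from_r] by blast
  qed
  show "nbhd E ?C \<inter> Q = {}"
  proof -
    have "t \<in> ?C" if "s \<in> ?C" "E s t" "t \<in> Q" for s t
    proof -
      have rs: "?r\<^sup>*\<^sup>* r s" using that(1) unfolding component_def by blast
      have "?r\<^sup>*\<^sup>* r t"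
        by (rule rtranclp.rtrancl_into_rtrancl[OF rs]) (use that sub[OF rs] in blast)
      then show ?thesis unfolding component_def by blast
    qed
    then show ?thesis unfolding nbhd_def by blast
  qed
qed

text \<open>When the pair is within a step of the shadow on \<open>p\<close>, one of its members
  becomes a third guard, and the robber is on \<open>p\<close> and captured or locked in a component
  of \<open>R - set p\<close>. By \<open>split\<close>, two of the three guards suffice for that
  component; the remaining one joins the other member of the pair as a free cop.\<close>

lemma guarding_a_third_path:
  assumes conf: "confined R S1 f1 S2 f2 D" and p: "guarded_path A E R p h" "set p \<subseteq> V"
    and split: "\<And>R'. R' \<subseteq> R - set p \<Longrightarrow> R' \<noteq> {} \<Longrightarrow> conn_on E R' \<Longrightarrow> nbhd E R' \<subseteq> nbhd E R \<union> set p \<Longrightarrow>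
      good R' f1 f2 (D \<union> set p) \<or> good R' f1 (\<lambda>r. p ! h r) (D \<union> set p) \<or>
      good R' f2 (\<lambda>r. p ! h r) (D \<union> set p)"
  shows "good R f1 f2 D"
proof -
  let ?f = "\<lambda>r. p ! h r"
  have win: "wins f1 f2 D c c r" if r: "r \<in> R" and c: "c \<in> set p" "nstep E c (p ! h r)" for r c
    unfolding wins_def
  proof (intro ballI impI)
    fix c1 c2 assume c12: "c1 \<in> D" "c2 \<in> D" "nstep E c1 (f1 r)" "nstep E c2 (f2 r)"
    show "cwin E [c1, c2, c, c] r"
    proof (cases "r \<in> set p")
      case True
      then have "p ! h r = r" using p(1) r unfolding guarded_path_def by blast
      then show ?thesis using cwin_capture[of c] c by simp
    next
      case False
      let ?R = "component (R - set p) r" and ?D = "D \<union> set p"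
      have rQ: "r \<in> R - set p" using r False by blast
      note C = component[OF rQ]
      have "nbhd E ?R \<subseteq> nbhd E R \<union> set p" using C(2,4) unfolding nbhd_def by blast
      then consider "good ?R f1 f2 ?D" | "good ?R f1 ?f ?D" | "good ?R f2 ?f ?D"
        using split[OF C(2) _ C(3)] C(1) by blast
      then show ?thesis
      proof cases
        case 1
        then show ?thesis using C(1) c c12 unfolding good_def wins_def by blast
      next
        case 2
        then have "cwin E [c1, c, c2, c] r" using C(1) c c12 unfolding good_def wins_def by blast
        then show ?thesis by (rule cwin_perm) simp
      next
        case 3
        then have "cwin E [c2, c, c1, c] r" using C(1) c c12 unfolding good_def wins_def by blast
        then show ?thesis by (rule cwin_perm) simp
      qed
    qed
  qed
  have start: "wins f1 f2 D (p ! 0) (p ! 0) r" if "r \<in> R" for r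
    using pair_chases_shadow[OF conf p(1) win that] by blast
  show ?thesis
    unfolding good_def
  proof (intro ballI)
    fix r d e assume r: "r \<in> R" "d \<in> D" "e \<in> D"
    have "p ! 0 \<in> V" using p unfolding guarded_path_def by (cases p) auto
    moreover have "e \<in> V" using conf r(3) unfolding confined_def by blast
    ultimately have walk: "E\<^sup>*\<^sup>* e (p ! 0)" using connected unfolding connected_graph_def by simp
    show "wins f1 f2 D d e r"
      by (rule free_cops_gather[OF conf r(2,3) pair_travels[OF conf walk start] r(1)])
  qed
qed

lemma successively_colour:
  "successively E p \<Longrightarrow> i < length p \<Longrightarrow> p ! i \<in> A \<longleftrightarrow> (even i \<longleftrightarrow> p ! 0 \<in> A)"
proof (induction i)
  case (Suc i)
  then have "E (p ! i) (p ! Suc i)" by (simp add: successively_conv_nth)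
  then show ?case using colour Suc by auto
qed auto

text \<open>A cop alternates between the ends of an edge so as to keep the robber's colour; a robber
  next to one end finds him on the other. This works for every \<open>R\<close>, and so supplies a
  guarded path where there are no two contacts to join.\<close>

lemma guarded_edge:
  assumes "E x y"
  shows "guarded_path A E R [x, y] (\<lambda>r. if r \<in> A \<longleftrightarrow> x \<in> A then 0 else 1)"
proof -
  have 1: "\<And>r i. i < length [x, y] \<Longrightarrow> i = 0 \<or> i = 1" by auto
  have 2: "r \<in> A \<longleftrightarrow> x \<notin> A" if "E r x" for r using colour[OF that] by blast
  have 3: "r \<in> A \<longleftrightarrow> x \<in> A" if "E r y" for r using colour[OF that] colour[OF assms] by blast
  show ?thesis
    unfolding guarded_path_def
  proof (intro conjI ballI allI impI)
    fix r i assume "i < length [x, y]" "E r ([x, y] ! i)"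
    then show "(if r \<in> A \<longleftrightarrow> x \<in> A then 0 else 1) = Suc i \<or> i = Suc (if r \<in> A \<longleftrightarrow> x \<in> A then 0 else 1)"
      using 1[of i] 2[of r] 3[of r] by auto
  qed (use assms colour in \<open>auto split: if_splits\<close>)
qed

section \<open>Shrinking the territory\<close>

text \<open>The index of \<open>r\<close> is its distance from \<open>x\<close> through \<open>R\<close>, folded back at the end \<open>y\<close> in such
  a way that its parity is kept.\<close>

lemma shortest_path_guarded:
  assumes R: "conn_on E R" and x: "x \<in> nbhd E R" and y: "y \<in> nbhd E R" and xy: "x \<noteq> y"
  obtains k h where "k \<noteq> []" "set k \<subseteq> R" "distinct (x # k @ [y])" "guarded_path A E R (x # k @ [y]) h"
proof -
  define walk where "walk r w \<longleftrightarrow> w \<noteq> [] \<and> set w \<subseteq> R \<and> successively E (x # w) \<and> last w = r" for r w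
  define d where "d r = (LEAST n. \<exists>w. walk r w \<and> length w = n)" for r
  have ext: "walk t (w @ [t])" if "walk s w" "E s t" "t \<in> R" for s t w
    using that unfolding walk_def by (auto simp: successively_append_iff successively_Cons)
  obtain r0 where r0: "r0 \<in> R" "E r0 x" using x unfolding nbhd_def by blast
  have first: "walk r [r]" if "r \<in> R" "E r x" for r
    using that E_sym unfolding walk_def by simp
  have "\<exists>w. walk r w" if r: "r \<in> R" for r
  proof -
    have "(\<lambda>a b. E a b \<and> a \<in> R \<and> b \<in> R)\<^sup>*\<^sup>* r0 r" using R r0 r unfolding conn_on_def by blast
    then show ?thesis
    proof induction
      case base
      then show ?case using first r0 by blast
    next
      case (step s t)
      then show ?case using ext by blast
    qed
  qed
  then have ex: "\<exists>n w. walk r w \<and> length w = n" if "r \<in> R" for r using that by blast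
  have d_walk: "\<exists>w. walk r w \<and> length w = d r" if "r \<in> R" for r
    unfolding d_def using LeastI_ex[OF ex[OF that]] .
  have d_le: "d r \<le> length w" if "walk r w" for r w
    unfolding d_def using that by (intro Least_le) blast
  have d_pos: "1 \<le> d r" if "r \<in> R" for r
  proof -
    obtain w where "walk r w" "length w = d r" using d_walk[OF \<open>r \<in> R\<close>] by blast
    then show ?thesis unfolding walk_def by (cases w) auto
  qed
  have d_first: "d r = 1" if "r \<in> R" "E r x" for r
    using d_le[OF first[OF that]] d_pos[OF that(1)] by simp
  have d_edge: "d t \<le> Suc (d s)" if "s \<in> R" "t \<in> R" "E s t" for s t
  proof -
    obtain w where w: "walk s w" "length w = d s" using d_walk[OF \<open>s \<in> R\<close>] by blast
    show ?thesis using d_le[OF ext[OF w(1) that(3,2)]] w(2) by simp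
  qed
  have d_colour: "r \<in> A \<longleftrightarrow> (even (d r) \<longleftrightarrow> x \<in> A)" if "r \<in> R" for r
  proof -
    obtain w where w: "walk r w" "length w = d r" using d_walk[OF \<open>r \<in> R\<close>] by blast
    then have "w \<noteq> []" "(x # w) ! length w = r" unfolding walk_def by (auto simp: last_conv_nth nth_Cons')
    then show ?thesis
      using successively_colour[of "x # w" "length w"] w unfolding walk_def by simp
  qed
  \<comment> \<open>Parity excludes equal distances. This is what turns the usual distance map,
    under which a shadow may stand still while the robber moves, into one that moves whenever he
    does.\<close>
  have d_step: "d t = Suc (d s) \<or> d s = Suc (d t)" if st: "s \<in> R" "t \<in> R" "E s t" for s t
  proof -
    have "even (d s) \<noteq> even (d t)" using d_colour st colour[OF st(3)] by blast
    then have "d s \<noteq> d t" by auto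
    then show ?thesis using d_edge[OF st] d_edge[OF st(2,1) E_sym[OF st(3)]] by linarith
  qed

  \<comment> \<open>Choosing the neighbour of \<open>y\<close> nearest to \<open>x\<close> ensures
    that no neighbour of \<open>y\<close> in \<open>R\<close> has distance below the length of
    \<open>k\<close>.\<close>
  define Q where "Q r \<longleftrightarrow> r \<in> R \<and> E r y" for r
  have "\<exists>r. Q r" using y unfolding nbhd_def Q_def by blast
  then obtain r1 where r1: "Q r1" and min: "\<And>r. Q r \<Longrightarrow> d r1 \<le> d r"
    using ex_has_least_nat[of Q _ d] by blast
  obtain k where k: "walk r1 k" and len: "length k = d r1" using d_walk r1 unfolding Q_def by blast
  let ?p = "x # k @ [y]" and ?n = "length k"
  have kR: "set k \<subseteq> R" "k \<noteq> []" "successively E (x # k)" "last k = r1" using k unfolding walk_def by auto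
  have sp: "successively E ?p"
    using kR r1 by (auto simp: successively_append_iff successively_Cons Q_def)
  \<comment> \<open>Prefixes of \<open>k\<close> bound the distances from above. From below, the
    distance drops by at most one per step back from \<open>r1\<close>. Hence the index of a vertex
    of \<open>k\<close> is its distance, with index 0 left for \<open>x\<close>.\<close>
  have dk_le: "d (k ! i) \<le> Suc i" if i: "i < ?n" for i
  proof -
    have "successively E (x # take (Suc i) k)"
      using kR(3) successively_append_iff[of E "x # take (Suc i) k" "drop (Suc i) k"] by simp
    then have "walk (k ! i) (take (Suc i) k)"
      using kR i unfolding walk_def by (auto simp: take_Suc_conv_app_nth dest: in_set_takeD)
    then show ?thesis using d_le[of "k ! i" "take (Suc i) k"] i by simp
  qed
  have dk_ge: "d r1 \<le> d (k ! (?n - Suc j)) + j" if "j < ?n" for j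
    using that
  proof (induction j)
    case 0
    then show ?case using kR by (simp add: last_conv_nth)
  next
    case (Suc j)
    let ?i = "?n - Suc (Suc j)"
    have i: "Suc ?i = ?n - Suc j" "Suc ?i < ?n" using Suc.prems by auto
    have "E (k ! ?i) (k ! Suc ?i)"
      using kR(3) i(2) by (cases k) (auto simp: successively_conv_nth)
    then have "d (k ! Suc ?i) \<le> Suc (d (k ! ?i))"
      using d_edge[of "k ! ?i" "k ! Suc ?i"] kR(1) i(2) by (meson Suc_lessD nth_mem subsetD)
    then show ?case using Suc i(1) by simp
  qed
  have dk: "d (k ! i) = Suc i" if i: "i < ?n" for i
    using dk_le[OF i] dk_ge[of "?n - Suc i"] i len by (simp add: Suc_diff_Suc)
  have dist: "distinct ?p"
  proof -
    have "distinct k" unfolding distinct_conv_nth using dk by (metis nat.inject)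
    then show ?thesis using kR(1) x y xy unfolding nbhd_def by auto
  qed

  \<comment> \<open>Distances beyond \<open>Suc ?n\<close>, the index of \<open>y\<close>, alternate
    between \<open>?n\<close> and \<open>Suc ?n\<close>. A neighbour of \<open>y\<close> has
    distance at least \<open>?n\<close> and of the same parity as \<open>?n\<close>, so its index is
    \<open>?n\<close>, next to \<open>y\<close>.\<close>
  define h where "h r = (if d r \<le> Suc ?n then d r else if even (d r - Suc ?n) then Suc ?n else ?n)" for r
  have h_even: "even (h r) \<longleftrightarrow> even (d r)" for r
  proof (cases "d r \<le> Suc ?n")
    case False
    then obtain m where "d r = Suc ?n + m" using le_Suc_ex[of "Suc ?n" "d r"] by auto
    then show ?thesis unfolding h_def by auto
  qed (simp add: h_def)
  have h_lt: "h r < length ?p" for r unfolding h_def by auto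
  have "guarded_path A E R ?p h"
    unfolding guarded_path_def
  proof (intro conjI ballI allI impI)
    fix r assume r: "r \<in> R"
    show "h r < length ?p" by (rule h_lt)
    show "?p ! h r \<in> A \<longleftrightarrow> r \<in> A"
      using successively_colour[OF sp h_lt] d_colour[OF r] h_even by simp
  next
    fix r r' assume rr: "r \<in> R" "r' \<in> R" "E r r'"
    show "h r' = Suc (h r) \<or> h r = Suc (h r')"
      using d_step[OF rr] unfolding h_def by (auto simp: Suc_diff_le le_Suc_eq)
  next
    fix r i assume r: "r \<in> R" and i: "i < length ?p" and e: "E r (?p ! i)"
    consider "i = 0" | j where "i = Suc j" "j < ?n" | "i = Suc ?n"
      using i by (cases i) (auto simp: less_Suc_eq)
    then show "h r = Suc i \<or> i = Suc (h r)"
    proof cases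
      case 1
      then have "d r = 1" using d_first r e by simp
      then show ?thesis using 1 unfolding h_def by simp
    next
      case 2
      then have pj: "?p ! i = k ! j" by (simp add: nth_append)
      have "k ! j \<in> R" using kR(1) 2 nth_mem by blast
      then have "d r = Suc (Suc j) \<or> Suc j = Suc (d r)"
        using d_step[of r "k ! j"] r e dk[OF 2(2)] pj by auto
      then show ?thesis using 2 unfolding h_def by auto
    next
      case 3
      then have ry: "E r y" using e by (simp add: nth_append)
      then have ge: "?n \<le> d r" using min[of r] r len unfolding Q_def by simp
      have "even (d r) \<longleftrightarrow> even ?n"
        using d_colour[OF r] d_colour[of r1] r1 colour[OF ry] colour[of r1 y] len unfolding Q_def by auto
      then have "h r = ?n" using ge unfolding h_def by (auto simp: le_Suc_eq)
      then show ?thesis using 3 by simp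
    qed
  next
    fix r assume "r \<in> R \<inter> set ?p"
    then have "r \<in> set k" using x y unfolding nbhd_def by auto
    then obtain j where "j < ?n" "r = k ! j" by (metis in_set_conv_nth)
    then show "?p ! h r = r" using dk unfolding h_def by (simp add: nth_append)
  qed (use sp in auto)
  then show ?thesis using that kR(1,2) dist by blast
qed

section \<open>Cycles and boundaries of territories\<close>

definition cycle :: "'a list \<Rightarrow> bool" where
  "cycle c \<longleftrightarrow> distinct c \<and> successively E c \<and> c \<noteq> [] \<and> E (last c) (hd c)"

lemma cycle_rotate: "cycle (u @ v) \<Longrightarrow> cycle (v @ u)"
  unfolding cycle_def by (cases "u = []"; cases "v = []") (auto simp: successively_append_iff)

lemma cycle_iff_two_paths:
  "cycle (x # m @ y # t) \<longleftrightarrow>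
    distinct (x # m @ y # t) \<and> successively E (x # m @ [y]) \<and> successively E (y # t @ [x])"
  unfolding cycle_def
  by (cases "t = []"; cases "m = []") (auto simp: successively_append_iff successively_Cons)

lemma path_rev: "successively E p \<Longrightarrow> successively E (rev p)"
  unfolding successively_rev by (erule successively_mono) (use E_sym in auto)

text \<open>Extreme contacts are taken because the parts \<open>a\<close> and \<open>b\<close>
  beyond them are then free of contacts, and may be added to the other piece of a cycle without a
  guard of their own.\<close>

lemma extreme_elements:
  assumes "distinct p"
  obtains a x m y b where "p = a @ x # m @ y # b" "x \<in> N" "y \<in> N" "set a \<inter> N = {}" "set b \<inter> N = {}"
  | z where "N \<inter> set p \<subseteq> {z}"
proof (cases "N \<inter> set p = {}")
  case True
  then show ?thesis using that(2) by blast
next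
  case False
  then obtain a x r where p: "p = a @ x # r" "x \<in> N" "\<forall>z\<in>set a. z \<notin> N"
    using split_list_first_prop[of p "\<lambda>z. z \<in> N"] by blast
  show ?thesis
  proof (cases "N \<inter> set r = {}")
    case True
    then show ?thesis using that(2)[of x] p by auto
  next
    case False
    then obtain m y b where "r = m @ y # b" "y \<in> N" "\<forall>z\<in>set b. z \<notin> N"
      using split_list_last_prop[of r "\<lambda>z. z \<in> N"] by blast
    then show ?thesis using that(1)[of a x m y b] p by blast
  qed
qed

definition on_path :: "'a set \<Rightarrow> 'a set \<Rightarrow> 'a set \<Rightarrow> bool" where
  "on_path R S D \<longleftrightarrow> (\<exists>p. successively E p \<and> distinct p \<and> set p \<subseteq> D \<and> nbhd E R \<subseteq> set p \<inter> S)"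

definition on_cycle :: "'a set \<Rightarrow> 'a set \<Rightarrow> 'a set \<Rightarrow> 'a set \<Rightarrow> bool" where
  "on_cycle R S1 S2 D \<longleftrightarrow> (\<exists>p q. cycle (p @ q) \<and> set (p @ q) \<subseteq> D \<and> nbhd E R \<subseteq> set (p @ q) \<and>
    nbhd E R \<inter> set p \<subseteq> S1 \<and> nbhd E R \<inter> set q \<subseteq> S2)"

text \<open>The two configurations of the induction: the robber's territory \<open>R\<close> is bounded by one guarded
  path, or by a cycle made of two guarded pieces.\<close>

definition territory ::
  "'a set \<Rightarrow> 'a set \<Rightarrow> ('a \<Rightarrow> 'a) \<Rightarrow> 'a set \<Rightarrow> ('a \<Rightarrow> 'a) \<Rightarrow> 'a set \<Rightarrow> bool" where
  "territory R S1 f1 S2 f2 D \<longleftrightarrow> confined R S1 f1 S2 f2 D \<and> conn_on E R \<and>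
    (on_path R S1 D \<or> on_cycle R S1 S2 D)"

lemma nbhd_nonempty:
  assumes "R \<subseteq> V" "R \<noteq> {}" "R \<noteq> V"
  shows "nbhd E R \<noteq> {}"
proof
  assume N: "nbhd E R = {}"
  obtain r v where rv: "r \<in> R" "v \<in> V" "v \<notin> R" using assms by blast
  then have "E\<^sup>*\<^sup>* r v" using connected assms(1) unfolding connected_graph_def by blast
  then have "v \<in> R"
  proof induction
    case (step s t)
    then show ?case using N unfolding nbhd_def by blast
  qed (use rv in blast)
  then show False using rv by blast
qed

context
  fixes R S1 f1 S2 f2 D p h
  assumes conf: "confined R S1 f1 S2 f2 D" and p: "guarded_path A E R p h" "set p \<subseteq> R \<union> D" "hd p \<in> D"
begin

text \<open>Letting each surviving guard be any of the three covers all ways of releasing one. The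
  path starts in \<open>D\<close>, so that \<open>D\<close> stays connected when it is
  added.\<close>

lemma confined_shrink:
  assumes R': "R' \<subseteq> R - set p"
    and SF: "(S, f) \<in> {(S1, f1), (S2, f2), (set p, \<lambda>r. p ! h r)}"
      "(S', f') \<in> {(S1, f1), (S2, f2), (set p, \<lambda>r. p ! h r)}"
    and N: "nbhd E R' \<subseteq> S \<union> S'"
  shows "confined R' S f S' f' (D \<union> set p)"
proof -
  have c: "R \<subseteq> V" "D \<subseteq> V" "D \<inter> R = {}" "conn_on E D" "shadow A E R S1 f1" "shadow A E R S2 f2"
    "f1 ` R \<subseteq> D" "f2 ` R \<subseteq> D"
    using conf unfolding confined_def by auto
  have "conn_on E (D \<union> set p)"
    using conn_on_Un[OF c(4) conn_on_path, of p "hd p"] p unfolding guarded_path_def by simp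
  moreover have "shadow A E R' T g \<and> g ` R' \<subseteq> D \<union> set p"
    if "(T, g) \<in> {(S1, f1), (S2, f2), (set p, \<lambda>r. p ! h r)}" for T g
  proof -
    have "(\<lambda>r. p ! h r) ` R \<subseteq> set p" using p(1) unfolding guarded_path_def by auto
    then have "shadow A E R T g \<and> g ` R \<subseteq> D \<union> set p"
      using that c shadow_guarded_path[OF p(1)] by auto
    then show ?thesis using shadow_mono[of R T g R'] R' by auto
  qed
  ultimately show ?thesis
    using c R' p(2) SF N unfolding confined_def by auto
qed

end

text \<open>There is no second contact to draw a path to. Guarding an edge from \<open>z\<close>
  into \<open>R\<close> still takes a vertex from the territory and leaves its boundary on one
  guarded path.\<close>

lemma good_if_single_contact:
  assumes conf: "confined R S1 f1 S2 f2 D" "conn_on E R" and N: "nbhd E R = {z}" "z \<in> D"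
    and IH: "\<And>R' T1 g1 T2 g2 D'. R' \<subset> R \<Longrightarrow> territory R' T1 g1 T2 g2 D' \<Longrightarrow> good R' g1 g2 D'"
  shows "good R f1 f2 D"
proof -
  obtain r where r: "r \<in> R" "E r z" using N unfolding nbhd_def by blast
  define h where "h = (\<lambda>r. if r \<in> A \<longleftrightarrow> z \<in> A then 0 else 1::nat)"
  have zr: "E z r" "z \<noteq> r" using r E_sym E_irrefl by auto
  have gp: "guarded_path A E R [z, r] h"
    using guarded_edge[OF zr(1)] unfolding h_def .
  show ?thesis
  proof (rule guarding_a_third_path[OF conf(1) gp])
    show "set [z, r] \<subseteq> V" using E_V[OF r(2)] by simp
    fix R' assume R': "R' \<subseteq> R - set [z, r]" "R' \<noteq> {}" "conn_on E R'" "nbhd E R' \<subseteq> nbhd E R \<union> set [z, r]"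
    have N': "nbhd E R' \<subseteq> set [z, r]" using R'(4) N by auto
    have "confined R' (set [z, r]) (\<lambda>r'. [z, r] ! h r') S1 f1 (D \<union> set [z, r])"
      by (rule confined_shrink[OF conf(1) gp]) (use R' N' N(2) r in auto)
    moreover have "on_path R' (set [z, r]) (D \<union> set [z, r])"
      unfolding on_path_def using N' zr by (intro exI[of _ "[z, r]"]) auto
    ultimately have "territory R' (set [z, r]) (\<lambda>r'. [z, r] ! h r') S1 f1 (D \<union> set [z, r])"
      using R'(3) unfolding territory_def by blast
    moreover have "R' \<subset> R" using R' r by auto
    ultimately show "good R' f1 f2 (D \<union> set [z, r]) \<or> good R' f1 (\<lambda>r'. [z, r] ! h r') (D \<union> set [z, r]) \<or>
      good R' f2 (\<lambda>r'. [z, r] ! h r') (D \<union> set [z, r])"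
      using IH good_commute by blast
  qed
qed

text \<open>This serves a cycle with one contact on each piece. The new path contains both contacts
  and alone guards what is left; the guard of \<open>S1\<close> is carried along idle.\<close>

lemma good_if_two_contacts:
  assumes conf: "confined R S1 f1 S2 f2 D" "conn_on E R" and N: "nbhd E R = {x, y}" "{x, y} \<subseteq> D" "x \<noteq> y"
    and IH: "\<And>R' T1 g1 T2 g2 D'. R' \<subset> R \<Longrightarrow> territory R' T1 g1 T2 g2 D' \<Longrightarrow> good R' g1 g2 D'"
  shows "good R f1 f2 D"
proof -
  obtain k h where k: "k \<noteq> []" "set k \<subseteq> R" "distinct (x # k @ [y])" and gp: "guarded_path A E R (x # k @ [y]) h"
    using shortest_path_guarded[OF conf(2), of x y] N by auto
  let ?p = "x # k @ [y]"
  have VD: "R \<subseteq> V" "D \<subseteq> V" using conf(1) unfolding confined_def by auto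
  show ?thesis
  proof (rule guarding_a_third_path[OF conf(1) gp])
    show "set ?p \<subseteq> V" using k N VD by auto
    fix R' assume R': "R' \<subseteq> R - set ?p" "R' \<noteq> {}" "conn_on E R'" "nbhd E R' \<subseteq> nbhd E R \<union> set ?p"
    have N': "nbhd E R' \<subseteq> set ?p" using R'(4) N by auto
    have "confined R' (set ?p) (\<lambda>r'. ?p ! h r') S1 f1 (D \<union> set ?p)"
      by (rule confined_shrink[OF conf(1) gp]) (use R' N' N k in auto)
    moreover have "on_path R' (set ?p) (D \<union> set ?p)"
      unfolding on_path_def using N' k gp unfolding guarded_path_def by (intro exI[of _ ?p]) auto
    ultimately have "territory R' (set ?p) (\<lambda>r'. ?p ! h r') S1 f1 (D \<union> set ?p)"
      using R'(3) unfolding territory_def by blast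
    moreover have "R' \<subset> R" using R' k by (cases k) auto
    ultimately show "good R' f1 f2 (D \<union> set ?p) \<or> good R' f1 (\<lambda>r'. ?p ! h r') (D \<union> set ?p) \<or>
      good R' f2 (\<lambda>r'. ?p ! h r') (D \<union> set ?p)"
      using IH good_commute by blast
  qed
qed

lemma nbhd_shrink: "R' \<subseteq> R \<Longrightarrow> D \<inter> R = {} \<Longrightarrow> nbhd E R' \<inter> D \<subseteq> nbhd E R"
  unfolding nbhd_def by blast

text \<open>The ends \<open>x\<close> and \<open>y\<close> are counted with the old segment; the
  second piece is the interior \<open>k\<close> alone, reversed to close the cycle.\<close>

lemma on_cycle_replace:
  assumes "successively E (x # m @ [y])" "distinct (x # m @ [y])" "set (x # m @ [y]) \<subseteq> D"
    and "successively E (x # k @ [y])" "distinct (x # k @ [y])" "set k \<subseteq> R" "D \<inter> R = {}"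
    and N': "nbhd E R' \<subseteq> set (x # m @ [y]) \<union> set k" "nbhd E R' \<inter> set (x # m @ [y]) \<subseteq> S1"
  shows "on_cycle R' S1 (set (x # k @ [y])) (D \<union> set (x # k @ [y]))"
proof -
  have "successively E (y # rev k @ [x])" using path_rev[OF assms(4)] by simp
  moreover have "distinct (x # m @ y # rev k)" using assms by auto
  ultimately have "cycle ((x # m @ [y]) @ rev k)" using cycle_iff_two_paths[of x m y "rev k"] assms(1) by simp
  then show ?thesis
    unfolding on_cycle_def using assms by (intro exI[of _ "x # m @ [y]"] exI[of _ "rev k"]) auto
qed

text \<open>One guard holds the whole old boundary, so the other can be exchanged for the guard of
  the new path. The territory is then enclosed by the old segment from \<open>x\<close> to
  \<open>y\<close> and the new path.\<close>

lemma good_on_path: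
  assumes conf: "confined R S1 f1 S2 f2 D" "conn_on E R"
    and p: "successively E (a @ x # m @ y # b)" "distinct (a @ x # m @ y # b)" "set (a @ x # m @ y # b) \<subseteq> D"
    and N: "nbhd E R \<subseteq> set (x # m @ [y]) \<inter> S1" "x \<in> nbhd E R" "y \<in> nbhd E R"
    and IH: "\<And>R' T1 g1 T2 g2 D'. R' \<subset> R \<Longrightarrow> territory R' T1 g1 T2 g2 D' \<Longrightarrow> good R' g1 g2 D'"
  shows "good R f1 f2 D"
proof -
  obtain k h where k: "k \<noteq> []" "set k \<subseteq> R" "distinct (x # k @ [y])" and gp: "guarded_path A E R (x # k @ [y]) h"
    using shortest_path_guarded[OF conf(2) N(2,3)] p by auto
  let ?p = "x # k @ [y]" and ?f = "\<lambda>r. (x # k @ [y]) ! h r"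
  have VD: "R \<subseteq> V" "D \<subseteq> V" "D \<inter> R = {}" using conf(1) unfolding confined_def by auto
  have xy: "x \<in> D" "y \<in> D" using p(3) by auto
  have sp: "successively E ?p" using gp unfolding guarded_path_def by blast
  have sm: "successively E (x # m @ [y])"
    using p(1) successively_append_iff[of E a "(x # m @ [y]) @ b"]
    by (simp add: successively_append_iff[of E "x # m @ [y]" b, simplified])
  have dm: "distinct (x # m @ [y])" "set (x # m @ [y]) \<subseteq> D" using p(2,3) by auto
  show ?thesis
  proof (rule guarding_a_third_path[OF conf(1) gp])
    show "set ?p \<subseteq> V" using k xy VD by auto
    fix R' assume R': "R' \<subseteq> R - set ?p" "R' \<noteq> {}" "conn_on E R'" "nbhd E R' \<subseteq> nbhd E R \<union> set ?p"
    have "nbhd E R' \<inter> D \<subseteq> nbhd E R" using nbhd_shrink R'(1) VD(3) by blast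
    then have N'S: "nbhd E R' \<inter> set (x # m @ [y]) \<subseteq> S1" using dm(2) N(1) by blast
    have N': "nbhd E R' \<subseteq> set (x # m @ [y]) \<union> set k" using R'(4) N(1) by auto
    have "confined R' S1 f1 (set ?p) ?f (D \<union> set ?p)"
      by (rule confined_shrink[OF conf(1) gp]) (use R' N' N'S k xy in auto)
    moreover have "on_cycle R' S1 (set ?p) (D \<union> set ?p)"
      by (rule on_cycle_replace[OF sm dm sp k(3) k(2) VD(3) N' N'S])
    ultimately have "territory R' S1 f1 (set ?p) ?f (D \<union> set ?p)"
      using R'(3) unfolding territory_def by blast
    moreover have "R' \<subset> R" using R' k by (cases k) auto
    ultimately show "good R' f1 f2 (D \<union> set ?p) \<or> good R' f1 ?f (D \<union> set ?p) \<or> good R' f2 ?f (D \<union> set ?p)"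
      using IH by blast
  qed
qed

text \<open>The interiors \<open>m\<close>, \<open>k\<close> and \<open>b @ q @ a\<close> form a
  theta graph with ends \<open>x\<close> and \<open>y\<close>, and a component of the rest misses
  one of them. Missing \<open>m\<close> releases the first guard, missing \<open>k\<close> the new
  one, missing \<open>b @ q @ a\<close> the second. In the first case the second guard suffices for
  \<open>b @ q @ a\<close>, since \<open>a\<close> and \<open>b\<close> have no contacts.\<close>

lemma good_on_cycle:
  assumes planar: "planar V E"
    and conf: "confined R S1 f1 S2 f2 D" "conn_on E R"
    and p: "cycle ((a @ x # m @ y # b) @ q)" "set ((a @ x # m @ y # b) @ q) \<subseteq> D"
    and N: "nbhd E R \<subseteq> set (x # m @ [y]) \<union> set q" "nbhd E R \<inter> set (x # m @ [y]) \<subseteq> S1"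
      "nbhd E R \<inter> set q \<subseteq> S2" "x \<in> nbhd E R" "y \<in> nbhd E R" "nbhd E R \<inter> set (a @ b) = {}"
    and IH: "\<And>R' T1 g1 T2 g2 D'. R' \<subset> R \<Longrightarrow> territory R' T1 g1 T2 g2 D' \<Longrightarrow> good R' g1 g2 D'"
  shows "good R f1 f2 D"
proof -
  have xy: "x \<noteq> y" "x \<in> D" "y \<in> D" using p unfolding cycle_def by auto
  obtain k h where k: "k \<noteq> []" "set k \<subseteq> R" "distinct (x # k @ [y])" and gp: "guarded_path A E R (x # k @ [y]) h"
    using shortest_path_guarded[OF conf(2) N(4,5) xy(1)] by auto
  let ?p = "x # k @ [y]" and ?f = "\<lambda>r. (x # k @ [y]) ! h r" and ?t = "b @ q @ a"
  have VD: "R \<subseteq> V" "D \<subseteq> V" "D \<inter> R = {}" using conf(1) unfolding confined_def by auto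
  have sp: "successively E ?p" using gp unfolding guarded_path_def by blast
  have "cycle (x # m @ y # ?t)" using cycle_rotate[of a "x # m @ y # b @ q"] p(1) by simp
  then have dist: "distinct (x # m @ y # ?t)" and sm: "successively E (x # m @ [y])"
    and st: "successively E (y # ?t @ [x])"
    unfolding cycle_iff_two_paths by auto
  have dm: "distinct (x # m @ [y])" "set (x # m @ [y]) \<subseteq> D" using dist p(2) by auto
  have tD: "set ?t \<subseteq> D" using p(2) by auto
  have "cycle (x # k @ y # ?t)"
    unfolding cycle_iff_two_paths using sp st k tD dist VD(3) by auto
  then have ck: "cycle (?t @ ?p)" using cycle_rotate[of ?p ?t] by simp
  show ?thesis
  proof (rule guarding_a_third_path[OF conf(1) gp])
    show "set ?p \<subseteq> V" using k xy VD by auto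
    fix R' assume R': "R' \<subseteq> R - set ?p" "R' \<noteq> {}" "conn_on E R'" "nbhd E R' \<subseteq> nbhd E R \<union> set ?p"
    have ND: "nbhd E R' \<inter> D \<subseteq> nbhd E R" using nbhd_shrink R'(1) VD(3) by blast
    have psub: "R' \<subset> R" using R' k by (cases k) auto
    have "nbhd E R' \<inter> set m = {} \<or> nbhd E R' \<inter> set k = {} \<or> nbhd E R' \<inter> set ?t = {}"
    proof (rule ccontr)
      assume ne: "\<not> ?thesis"
      have touch: "\<exists>s\<in>set l - {x, y}. \<exists>r\<in>R'. E r s"
        if T: "nbhd E R' \<inter> T \<noteq> {}" "T \<subseteq> set l" "x \<notin> T" "y \<notin> T" for T l
      proof -
        obtain s where "s \<in> nbhd E R'" "s \<in> T" using T(1) by blast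
        then show ?thesis using T(2-4) unfolding nbhd_def by blast
      qed
      have RD: "R' \<inter> D = {}" using R'(1) VD(3) by blast
      have "False"
      proof (rule planar_no_theta_contact[OF graph planar, of "x # m @ [y]" ?p "rev (y # ?t @ [x])" x y R'])
        show "set (x # m @ [y]) \<inter> set ?p = {x, y}" using dm k VD(3) by auto
        show "set (x # m @ [y]) \<inter> set (rev (y # ?t @ [x])) = {x, y}" using dist by auto
        show "set ?p \<inter> set (rev (y # ?t @ [x])) = {x, y}" using tD k VD(3) by auto
        show "R' \<subseteq> V" using R'(1) VD by blast
        fix l assume l: "l \<in> {x # m @ [y], ?p, rev (y # ?t @ [x])}"
        have "\<exists>s\<in>set l - {x, y}. \<exists>r\<in>R'. E r s"
        proof -
          consider "l = x # m @ [y]" | "l = ?p" | "l = rev (y # ?t @ [x])" using l by blast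
          then show ?thesis
          proof cases
            case 1
            show ?thesis by (rule touch[of "set m"]) (use ne 1 dist in auto)
          next
            case 2
            show ?thesis by (rule touch[of "set k"]) (use ne 2 k in auto)
          next
            case 3
            show ?thesis by (rule touch[of "set ?t"]) (use ne 3 dist in auto)
          qed
        qed
        moreover have "successively E l" using l sm sp path_rev[OF st] by blast
        moreover have "distinct l" using l dm k(3) dist by auto
        moreover have "hd l = x \<and> last l = y" using l by auto
        moreover have "set l \<subseteq> D \<union> set ?p" using l dm(2) tD xy by auto
        then have "set l \<inter> R' = {}" using R'(1) RD by blast
        ultimately show "successively E l \<and> distinct l \<and> hd l = x \<and> last l = y \<and> set l \<inter> R' = {} \<and>
          (\<exists>s\<in>set l - {x, y}. \<exists>r\<in>R'. E r s)" by blast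
      qed (rule R'(3))
      then show False .
    qed
    then consider "nbhd E R' \<inter> set m = {}" | "nbhd E R' \<inter> set k = {}" | "nbhd E R' \<inter> set ?t = {}" by blast
    then show "good R' f1 f2 (D \<union> set ?p) \<or> good R' f1 ?f (D \<union> set ?p) \<or> good R' f2 ?f (D \<union> set ?p)"
    proof cases
      case 1
      have N't: "nbhd E R' \<inter> set ?t \<subseteq> S2" using ND tD N(3,6) by auto
      have N': "nbhd E R' \<subseteq> set ?t \<union> set ?p" using R'(4) N(1) 1 by auto
      have "confined R' S2 f2 (set ?p) ?f (D \<union> set ?p)"
        by (rule confined_shrink[OF conf(1) gp]) (use R' N' N't k xy in auto)
      moreover have "on_cycle R' S2 (set ?p) (D \<union> set ?p)"
        unfolding on_cycle_def using ck tD N' N't by (intro exI[of _ ?t] exI[of _ ?p]) auto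
      ultimately have "territory R' S2 f2 (set ?p) ?f (D \<union> set ?p)"
        using R'(3) unfolding territory_def by blast
      then show ?thesis using IH[OF psub] by blast
    next
      case 2
      have N': "nbhd E R' \<subseteq> nbhd E R" using R'(4) 2 N(4,5) by auto
      then have NS: "nbhd E R' \<subseteq> S1 \<union> S2" using N(1-3) by blast
      have "confined R' S1 f1 S2 f2 (D \<union> set ?p)"
        by (rule confined_shrink[OF conf(1) gp]) (use R' NS k xy in auto)
      moreover have "on_cycle R' S1 S2 (D \<union> set ?p)"
        unfolding on_cycle_def using p N N'
        by (intro exI[of _ "a @ x # m @ y # b"] exI[of _ q]) auto
      ultimately have "territory R' S1 f1 S2 f2 (D \<union> set ?p)"
        using R'(3) unfolding territory_def by blast
      then show ?thesis using IH[OF psub] by blast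
    next
      case 3
      have N'S: "nbhd E R' \<inter> set (x # m @ [y]) \<subseteq> S1" using dm(2) ND N(2) by blast
      have N': "nbhd E R' \<subseteq> set (x # m @ [y]) \<union> set k" using R'(4) N(1) 3 by auto
      have "confined R' S1 f1 (set ?p) ?f (D \<union> set ?p)"
        by (rule confined_shrink[OF conf(1) gp]) (use R' N' N'S k xy in auto)
      moreover have "on_cycle R' S1 (set ?p) (D \<union> set ?p)"
        by (rule on_cycle_replace[OF sm dm sp k(3) k(2) VD(3) N' N'S])
      ultimately have "territory R' S1 f1 (set ?p) ?f (D \<union> set ?p)"
        using R'(3) unfolding territory_def by blast
      then show ?thesis using IH[OF psub] by blast
    qed
  qed
qed

text \<open>The induction on \<open>card R\<close> works because each new path, or edge, takes at
  least one vertex of \<open>R\<close>.\<close>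

theorem good_territory:
  assumes planar: "planar V E"
  shows "territory R S1 f1 S2 f2 D \<Longrightarrow> good R f1 f2 D"
proof (induction "card R" arbitrary: R S1 f1 S2 f2 D rule: less_induct)
  case less
  have conf: "confined R S1 f1 S2 f2 D" and conn: "conn_on E R"
    using less.prems unfolding territory_def by auto
  have VD: "R \<subseteq> V" "D \<subseteq> V" "D \<inter> R = {}" using conf unfolding confined_def by auto
  have "finite R" using VD finite_V finite_subset by blast
  then have IH: "good R' g1 g2 D'" if "R' \<subset> R" "territory R' T1 g1 T2 g2 D'" for R' T1 g1 T2 g2 D'
    using less.hyps[OF psubset_card_mono[OF _ that(1)] that(2)] by blast
  have swap: "confined R S2 f2 S1 f1 D" using conf unfolding confined_def by auto
  show ?case
  proof (cases "R = {} \<or> D = {}")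
    case True
    then show ?thesis unfolding good_def by blast
  next
    case False
    then have ne: "nbhd E R \<noteq> {}" using nbhd_nonempty[OF VD(1)] VD by blast
    have path: "good R f1 f2 D" if op: "on_path R S1 D"
    proof -
      obtain p where p: "successively E p" "distinct p" "set p \<subseteq> D" "nbhd E R \<subseteq> set p \<inter> S1"
        using op unfolding on_path_def by blast
      from p(2) show ?thesis
      proof (cases rule: extreme_elements[where N = "nbhd E R"])
        case (1 a x m y b)
        have sub: "nbhd E R \<subseteq> set (x # m @ [y]) \<inter> S1" using p(4) 1 by auto
        show ?thesis
          by (rule good_on_path[OF conf conn, of a x m y b]) (use p 1 sub IH in auto)
      next
        case (2 z)
        then have z: "nbhd E R = {z}" using p(4) ne by blast
        have "z \<in> D" using z p(3,4) by blast
        show ?thesis by (rule good_if_single_contact[OF conf conn z \<open>z \<in> D\<close>]) (rule IH)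
      qed
    qed
    have cyc: "good R f1 f2 D" if "on_cycle R S1 S2 D"
    proof -
      obtain p q where pq: "cycle (p @ q)" "set (p @ q) \<subseteq> D" "nbhd E R \<subseteq> set (p @ q)"
        "nbhd E R \<inter> set p \<subseteq> S1" "nbhd E R \<inter> set q \<subseteq> S2"
        using \<open>on_cycle R S1 S2 D\<close> unfolding on_cycle_def by blast
      have "distinct p" "distinct q" using pq(1) unfolding cycle_def by auto
      from this(1) show ?thesis
      proof (cases rule: extreme_elements[where N = "nbhd E R"])
        case (1 a x m y b)
        show ?thesis
          by (rule good_on_cycle[OF planar conf conn, of a x m y b q]) (use pq 1 IH in auto)
      next
        \<comment> \<open>With at most one contact on \<open>p\<close>, either \<open>q\<close> has
          two and the pieces exchange their roles, or there are at most two contacts in all.\<close>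
        case p: (2 z)
        from \<open>distinct q\<close> show ?thesis
        proof (cases rule: extreme_elements[where N = "nbhd E R"])
          case (1 a x m y b)
          have "cycle (q @ p)" using cycle_rotate pq(1) by blast
          then have "good R f2 f1 D"
            by (intro good_on_cycle[OF planar swap conn, of a x m y b p]) (use pq 1 IH in auto)
          then show ?thesis by (rule good_commute)
        next
          case (2 z')
          then have sub: "nbhd E R \<subseteq> {z, z'}" using p pq(3) by auto
          have ND: "nbhd E R \<subseteq> D" using pq(2,3) by blast
          consider u where "nbhd E R = {u}" | "nbhd E R = {z, z'}" "z \<noteq> z'"
            using sub ne by blast
          then show ?thesis
          proof cases
            case (1 u)
            then show ?thesis using ND by (intro good_if_single_contact[OF conf conn, of u] IH) auto
          next
            case 2
            then show ?thesis using ND by (intro good_if_two_contacts[OF conf conn, of z z'] IH) auto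
          qed
        qed
      qed
    qed
    show ?thesis using path cyc less.prems unfolding territory_def by blast
  qed
qed

section \<open>The opening position\<close>

theorem four_cops_win:
  assumes planar: "planar V E"
  shows "cops_win V E 4"
proof -
  obtain v where v: "v \<in> V" using graph unfolding graph_def by blast
  have "cwin E [v, v, v, v] r" if r: "r \<in> V" for r
  proof (cases "nbhd E {v} = {}")
    case True
    then have "V = {v}" using nbhd_nonempty[of "{v}"] v by blast
    then show ?thesis using r cwin_capture[of v] by (simp add: nstep_def)
  next
    case False
    then obtain w where vw: "E v w" unfolding nbhd_def by blast
    show ?thesis
    proof (cases "r \<in> {v, w}")
      case True
      then show ?thesis using cwin_capture[of v] vw by (auto simp: nstep_def)
    next
      case False
      define h where "h = (\<lambda>r. if r \<in> A \<longleftrightarrow> v \<in> A then 0 else 1::nat)"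
      let ?R = "component (V - {v, w}) r" and ?f = "\<lambda>r. [v, w] ! h r" and ?D = "set [v, w]"
      have rQ: "r \<in> V - {v, w}" using r False by blast
      note C = component[OF rQ]
      have sh: "shadow A E ?R ?D ?f"
        by (rule shadow_guarded_path) (use guarded_edge[OF vw] in \<open>simp add: h_def\<close>)
      have fD: "?f r' \<in> ?D" for r' unfolding h_def by simp
      have N: "nbhd E ?R \<subseteq> ?D" using C(2,4) E_V unfolding nbhd_def by fastforce
      \<comment> \<open>Both guards are given the same edge, which brings the robber into the
        configuration bounded by one guarded path.\<close>
      have "confined ?R ?D ?f ?D ?f ?D"
        unfolding confined_def
      proof (intro conjI)
        show "conn_on E ?D" by (rule conn_on_path) (use vw in simp)
      qed (use C(2) E_V[OF vw] sh fD N in auto)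
      moreover have "on_path ?R ?D ?D"
        unfolding on_path_def using vw N E_irrefl by (intro exI[of _ "[v, w]"]) auto
      ultimately have "good ?R ?f ?f ?D"
        using good_territory[OF planar] C(3) unfolding territory_def by blast
      moreover have "nstep E v (?f r)" using vw unfolding h_def nstep_def by simp
      ultimately show ?thesis using C(1) unfolding good_def wins_def by simp
    qed
  qed
  then show ?thesis
    unfolding cops_win_def using v by (intro exI[of _ "[v, v, v, v]"]) auto
qed

end

section \<open>Evading three cops on a subdivided graph\<close>

lemma set_subset_insert_remove1: "set xs \<subseteq> insert a (set (remove1 a xs))"
  using in_set_remove1 by fastforce

text \<open>\<open>E\<close> arises from a graph with vertex set \<open>B\<close>, minimum degree 3 and girth at least 5 by
  subdividing every edge once.\<close>

locale subdivision =
  fixes V B :: "'a set" and E :: "'a \<Rightarrow> 'a \<Rightarrow> bool"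
  assumes graph: "graph V E" and B: "B \<subseteq> V" "7 \<le> card B"
    and bip: "E u v \<Longrightarrow> u \<in> B \<longleftrightarrow> v \<notin> B"
    and two_ends: "m \<in> V - B \<Longrightarrow> \<exists>u w. u \<noteq> w \<and> {v. E m v} = {u, w}"
    and degree: "u \<in> B \<Longrightarrow> \<exists>m1 m2. E u m1 \<and> E u m2 \<and> m1 \<noteq> m2 \<and> m1 \<noteq> m \<and> m2 \<noteq> m"
    and simple: "E u m \<Longrightarrow> E m w \<Longrightarrow> E u m' \<Longrightarrow> E m' w \<Longrightarrow> u \<in> B \<Longrightarrow> u \<noteq> w \<Longrightarrow> m = m'"
    and no_triangle: "E u m1 \<Longrightarrow> E m1 v \<Longrightarrow> E v m2 \<Longrightarrow> E m2 w \<Longrightarrow> E w m3 \<Longrightarrow> E m3 u \<Longrightarrow>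
      u \<in> B \<Longrightarrow> u \<noteq> v \<Longrightarrow> v \<noteq> w \<Longrightarrow> w \<noteq> u \<Longrightarrow> False"
    and no_square: "E u m1 \<Longrightarrow> E m1 v \<Longrightarrow> E v m2 \<Longrightarrow> E m2 x \<Longrightarrow> E x m3 \<Longrightarrow> E m3 w \<Longrightarrow> E w m4 \<Longrightarrow> E m4 u \<Longrightarrow>
      u \<in> B \<Longrightarrow> u \<noteq> v \<Longrightarrow> v \<noteq> x \<Longrightarrow> x \<noteq> w \<Longrightarrow> w \<noteq> u \<Longrightarrow> u \<noteq> x \<Longrightarrow> v \<noteq> w \<Longrightarrow> False"
begin

lemma sym: "E u v \<Longrightarrow> E v u" and E_V: "E u v \<Longrightarrow> u \<in> V"
  using graph unfolding graph_def by auto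

text \<open>A cop moves once before the robber reaches \<open>w\<close>; if he is not
  \<open>near\<close>, he is afterwards neither on \<open>w\<close> nor adjacent to it.\<close>

definition near :: "'a \<Rightarrow> 'a \<Rightarrow> bool" where
  "near c w \<longleftrightarrow> (\<exists>x. nstep E c x \<and> nstep E x w)"

lemma near_mid: "m \<notin> B \<Longrightarrow> w \<in> B \<Longrightarrow> near m w \<Longrightarrow> E m w"
  using bip unfolding near_def nstep_def by blast

lemma near_branch: "c \<in> B \<Longrightarrow> w \<in> B \<Longrightarrow> near c w \<Longrightarrow> c = w \<or> (\<exists>m. E c m \<and> E m w)"
  using bip unfolding near_def nstep_def by blast

lemma near_both_ends:
  assumes u: "u \<in> B" "E u m1" "E m1 w1" "w1 \<noteq> u" "E u m2" "E m2 w2" "w2 \<noteq> u" "m1 \<noteq> m2"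
    and x: "near x w1" "near x w2"
  shows "x = u"
proof (rule ccontr)
  assume "x \<noteq> u"
  have w: "w1 \<in> B" "w2 \<in> B" using u bip by blast+
  have "w1 \<noteq> w2" using simple u by metis
  have no_link: "\<not> (E w1 m \<and> E m w2)" for m
    using no_triangle[of u m1 w1 m w2 m2] u sym \<open>w1 \<noteq> w2\<close> by blast
  show False
  proof (cases "x \<in> B")
    case False
    then show False using near_mid w x no_link sym by blast
  next
    case True
    consider "x = w1" | "x = w2" | n1 n2 where "E x n1" "E n1 w1" "E x n2" "E n2 w2" "x \<noteq> w1" "x \<noteq> w2"
      using near_branch[OF True w(1) x(1)] near_branch[OF True w(2) x(2)] by blast
    then show False
    proof cases
      case 1
      then show False using near_branch[OF w x(2)[unfolded 1]] no_link \<open>w1 \<noteq> w2\<close> by blast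
    next
      case 2
      then show False using near_branch[OF w(2,1) x(1)[unfolded 2]] no_link \<open>w1 \<noteq> w2\<close> sym by blast
    next
      case 3
      then show False
        using no_square[of u m1 w1 n1 x n2 w2 m2] u sym \<open>w1 \<noteq> w2\<close> \<open>x \<noteq> u\<close> by metis
    qed
  qed
qed

text \<open>Positions with the cops to move from which the robber is never caught: on an original vertex out
  of reach; in the middle of an edge with one cop already eliminated; in the middle of an edge on
  the way to an original vertex which he reaches before every cop.\<close>

definition safe :: "'a list \<Rightarrow> 'a \<Rightarrow> bool" where
  "safe cs r \<longleftrightarrow>
    r \<in> B \<and> length cs \<le> 3 \<and> (\<forall>c\<in>set cs. \<not> nstep E c r) \<or>
    r \<in> V - B \<and> length cs \<le> 2 \<and> (\<forall>c\<in>set cs. \<not> nstep E c r) \<or>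
    r \<in> V - B \<and> length cs \<le> 3 \<and> (\<exists>w. E r w \<and> (\<forall>c\<in>set cs. \<not> near c w))"

lemma safe_not_captured:
  assumes "safe cs r" "c \<in> set cs"
  shows "\<not> nstep E c r"
  using assms unfolding safe_def near_def nstep_def by blast

abbreviation after :: "'a list \<Rightarrow> 'a \<Rightarrow> 'a list" where
  "after cs r \<equiv> if r \<in> set cs then remove1 r cs else cs"

lemma robber_moves_from_branch:
  assumes u: "u \<in> B" "u \<notin> set cs" and len: "length cs \<le> 3"
  shows "\<exists>r. nstep E u r \<and> safe (after cs r) r"
proof (cases "\<exists>m\<in>set cs. E m u")
  case False
  then have "\<forall>c\<in>set cs. \<not> nstep E c u" using u(2) unfolding nstep_def by blast
  then have "safe (after cs u) u" using u len unfolding safe_def by auto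
  then show ?thesis unfolding nstep_def by blast
next
  case True
  then obtain m where m: "m \<in> set cs" "E m u" by blast
  have mB: "m \<in> V - B" using m(2) u(1) bip E_V by blast
  show ?thesis
  proof (cases "\<exists>c\<in>set (remove1 m cs). nstep E c m")
    case False
    have "length (remove1 m cs) \<le> 2" using m(1) len by (simp add: length_remove1)
    then have "safe (after cs m) m" using False m(1) mB unfolding safe_def by auto
    then show ?thesis using m(2) sym unfolding nstep_def by blast
  next
    case True
    then obtain c where c: "c \<in> set (remove1 m cs)" "nstep E c m" by blast
    have "length (remove1 c (remove1 m cs)) \<le> 1"
      using m(1) c(1) len by (simp add: length_remove1)
    \<comment> \<open>If no third cop is left, any cop serves as \<open>x\<close>; membership in
      \<open>cs\<close> is kept because it gives \<open>x \<noteq> u\<close>.\<close>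
    then obtain x where x: "set (remove1 c (remove1 m cs)) \<subseteq> {x}" "x \<in> set cs"
    proof (cases "remove1 c (remove1 m cs)")
      case (Cons z zs)
      then have "z \<in> set cs" by (metis list.set_intros(1) notin_set_remove1)
      then show ?thesis using Cons that[of z] \<open>length _ \<le> 1\<close> by simp
    qed (use that m(1) in auto)
    have cs: "set cs \<subseteq> {m, c, x}"
      using set_subset_insert_remove1[of cs m] set_subset_insert_remove1[of "remove1 m cs" c] x(1) by blast
    obtain m1 m2 where m12: "E u m1" "E u m2" "m1 \<noteq> m2" "m1 \<noteq> m" "m2 \<noteq> m"
      using degree[OF u(1), of m] by blast
    have far_end: "\<exists>w. E n w \<and> w \<noteq> u" if "E u n" for n
    proof -
      have "n \<in> V - B" using that u(1) bip E_V sym by blast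
      then obtain a b where "a \<noteq> b" "{v. E n v} = {a, b}" using two_ends by blast
      then show ?thesis by (metis insertI1 insert_commute mem_Collect_eq)
    qed
    obtain w1 w2 where w: "E m1 w1" "w1 \<noteq> u" "E m2 w2" "w2 \<noteq> u" using far_end m12(1,2) by blast
    have "x \<noteq> u" using x(2) u(2) by blast
    then have "\<not> near x w1 \<or> \<not> near x w2" using near_both_ends[of u m1 w1 m2 w2 x] u(1) m12 w by blast
    then obtain n w where n: "E u n" "n \<noteq> m" "E n w" "w \<noteq> u" "\<not> near x w"
      using m12 w by blast
    have wB: "w \<in> B" "n \<in> V - B" using n u(1) bip E_V sym by blast+
    have mw: "\<not> E m w" using simple[of u m w n] n u(1) m(2) sym by blast
    then have far_m: "\<not> near m w" using near_mid mB wB by blast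
    \<comment> \<open>The protector \<open>c\<close> is on \<open>m\<close> or at the far end of
      that edge; from the far end, a link to \<open>w\<close> would complete a triangle.\<close>
    have far_c: "\<not> near c w"
    proof
      assume near: "near c w"
      have "c \<noteq> u" using c(1) u(2) by (metis notin_set_remove1)
      have "c \<noteq> m" using near far_m by blast
      then have cm: "E c m" using c(2) unfolding nstep_def by blast
      then have "c \<in> B" using bip mB by blast
      moreover have "c \<noteq> w" using cm mw sym by blast
      ultimately obtain k where "E c k" "E k w" using near_branch wB(1) near by blast
      then show False
        using no_triangle[of u m c k w n] u(1) m(2) cm n sym \<open>c \<noteq> u\<close> \<open>c \<noteq> w\<close> by metis
    qed
    have far: "\<forall>c\<in>set cs. \<not> near c w" using cs far_m far_c n(5) by blast
    moreover have "n \<notin> set cs" using far n(3) unfolding near_def nstep_def by blast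
    ultimately have "safe (after cs n) n" using n(3) wB(2) len unfolding safe_def by auto
    then show ?thesis using n(1) unfolding nstep_def by blast
  qed
qed

text \<open>Each end must be threatened by its own cop, since a cop within a step of both would
  stand on \<open>m\<close>. A cop standing on an end is then unprotected and is attacked. If both
  cops are on subdividing vertices, neither is within a step of \<open>m\<close>, and the robber
  passes.\<close>

lemma robber_moves_from_midpoint:
  assumes m: "m \<in> V - B" "m \<notin> set cs" and len: "length cs \<le> 2"
  shows "\<exists>r. nstep E m r \<and> safe (after cs r) r"
proof -
  obtain u w where uw: "u \<noteq> w" "{v. E m v} = {u, w}" using two_ends[OF m(1)] by blast
  have go: ?thesis if "E m v" "\<forall>c\<in>set cs. \<not> nstep E c v" for v
  proof -
    have "v \<in> B" "v \<notin> set cs" using that m(1) bip unfolding nstep_def by blast+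
    then have "safe (after cs v) v" using that len unfolding safe_def by auto
    then show ?thesis using that(1) unfolding nstep_def by blast
  qed
  have eat: ?thesis if v: "E m v" "v \<in> set cs" "\<forall>c\<in>set (remove1 v cs). \<not> nstep E c v" for v
  proof -
    have "v \<in> B" using v m(1) bip by blast
    then have "safe (after cs v) v" using v len unfolding safe_def by (auto simp: length_remove1)
    then show ?thesis using v(1) unfolding nstep_def by blast
  qed
  have Euw: "E m u" "E m w" using uw(2) by auto
  have uwB: "u \<in> B" "w \<in> B" using Euw m(1) bip by blast+
  have apart: "\<not> (nstep E c u \<and> nstep E c w)" if "c \<in> set cs" for c
    using simple[of u c w m] Euw uwB uw(1) bip sym m(2) that unfolding nstep_def by metis
  show ?thesis
  proof (cases "(\<exists>c\<in>set cs. nstep E c u) \<and> (\<exists>c\<in>set cs. nstep E c w)")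
    case False
    then show ?thesis using go Euw by blast
  next
    case True
    then obtain a b where ab: "a \<in> set cs" "nstep E a u" "b \<in> set cs" "nstep E b w" by blast
    then have "a \<noteq> b" using apart by blast
    have rem: "set (remove1 a cs) \<subseteq> {b}" "set (remove1 b cs) \<subseteq> {a}"
    proof -
      have *: "set (remove1 x cs) \<subseteq> {y}" if "x \<in> set cs" "y \<in> set cs" "x \<noteq> y" for x y
      proof -
        have "y \<in> set (remove1 x cs)" "length (remove1 x cs) \<le> 1"
          using that len by (auto simp: length_remove1)
        then show ?thesis by (cases "remove1 x cs") auto
      qed
      show "set (remove1 a cs) \<subseteq> {b}" "set (remove1 b cs) \<subseteq> {a}" using * ab \<open>a \<noteq> b\<close> by blast+
    qed
    consider "a = u" | "b = w" | "a \<noteq> u" "b \<noteq> w" by blast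
    then show ?thesis
    proof cases
      case 1
      then show ?thesis using eat[of u] Euw ab rem apart by blast
    next
      case 2
      then show ?thesis using eat[of w] Euw ab rem apart by blast
    next
      case 3
      have "E a u" "E b w" using ab 3 unfolding nstep_def by blast+
      then have "a \<notin> B" "b \<notin> B" using uwB bip by blast+
      moreover have "set cs \<subseteq> {a, b}"
        using set_subset_insert_remove1[of cs a] rem(1) by blast
      ultimately have "\<forall>c\<in>set cs. \<not> nstep E c m" using m bip unfolding nstep_def by blast
      then have "safe (after cs m) m" using m len unfolding safe_def by auto
      then show ?thesis unfolding nstep_def by blast
    qed
  qed
qed

lemma safe_not_cwin: "cwin E cs r \<Longrightarrow> \<not> safe cs r"
proof (induction rule: cwin.induct)
  case (1 cs cs' r)
  show ?case
  proof
    assume s: "safe cs r"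
    have len: "length cs' = length cs" using 1(1) by (simp add: list_all2_lengthD)
    have origin: "\<exists>c\<in>set cs. nstep E c c'" if "c' \<in> set cs'" for c'
      using 1(1) that by (metis in_set_conv_nth list_all2_conv_all_nth)
    then have nr: "r \<notin> set cs'" using safe_not_captured[OF s] by blast
    have "\<exists>r'. nstep E r r' \<and> safe (after cs' r') r'"
    proof -
      consider "r \<in> B" "length cs \<le> 3" | "r \<in> V - B" "length cs \<le> 2"
        | w where "r \<in> V - B" "length cs \<le> 3" "E r w" "\<forall>c\<in>set cs. \<not> near c w"
        using s unfolding safe_def by blast
      then show ?thesis
      proof cases
        case 1
        then show ?thesis using robber_moves_from_branch nr len by simp
      next
        case 2
        then show ?thesis using robber_moves_from_midpoint nr len by simp
      next
        case 3
        then have far: "\<forall>c\<in>set cs'. \<not> nstep E c w" using origin unfolding near_def by blast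
        moreover have "w \<in> B" using 3 bip by blast
        moreover have "w \<notin> set cs'" using far unfolding nstep_def by blast
        ultimately have "safe (after cs' w) w" using len 3(2) unfolding safe_def by simp
        then show ?thesis using 3(3) unfolding nstep_def by blast
      qed
    qed
    then show False using 1(2) nr by blast
  qed
qed

theorem three_cops_lose:
  assumes "k \<le> 3"
  shows "\<not> cops_win V E k"
proof
  assume "cops_win V E k"
  then obtain cs where cs: "length cs = k" "set cs \<subseteq> V" "\<forall>r\<in>V. cwin E cs r"
    unfolding cops_win_def by blast
  \<comment> \<open>This is where the bound 7 comes from: each cop is on or next to at most two
    original vertices, so three cops threaten at most six.\<close>
  have card2: "finite {u \<in> B. nstep E c u} \<and> card {u \<in> B. nstep E c u} \<le> 2" if c: "c \<in> V" for c
  proof -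
    have "\<exists>u w. {u \<in> B. nstep E c u} \<subseteq> {u, w}"
    proof (cases "c \<in> B")
      case True
      then have "{u \<in> B. nstep E c u} \<subseteq> {c, c}" using bip unfolding nstep_def by blast
      then show ?thesis by blast
    next
      case False
      then obtain u w where "{v. E c v} = {u, w}" using two_ends c by blast
      then have "{u \<in> B. nstep E c u} \<subseteq> {u, w}" using False unfolding nstep_def by blast
      then show ?thesis by blast
    qed
    then obtain u w where sub: "{u \<in> B. nstep E c u} \<subseteq> {u, w}" by blast
    have "card {u, w} \<le> 2" by (simp add: card_insert_if)
    then show ?thesis using card_mono[OF _ sub] finite_subset[OF sub] by simp
  qed
  have "card (\<Union>c\<in>set cs. {u \<in> B. nstep E c u}) \<le> (\<Sum>c\<in>set cs. card {u \<in> B. nstep E c u})"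
    by (rule card_UN_le) simp
  also have "\<dots> \<le> (\<Sum>c\<in>set cs. 2)" using card2 cs(2) by (intro sum_mono) blast
  also have "\<dots> \<le> 6" using card_length[of cs] cs(1) assms by simp
  finally have "card (\<Union>c\<in>set cs. {u \<in> B. nstep E c u}) < card B" using B(2) by simp
  moreover have "finite (\<Union>c\<in>set cs. {u \<in> B. nstep E c u})" using card2 cs(2) by blast
  ultimately have "\<not> B \<subseteq> (\<Union>c\<in>set cs. {u \<in> B. nstep E c u})" using card_mono leD by blast
  then obtain u where u: "u \<in> B" "\<forall>c\<in>set cs. \<not> nstep E c u" by blast
  then have "safe cs u" using cs(1) assms unfolding safe_def by blast
  moreover have "cwin E cs u" using cs(3) u(1) B(1) by blast
  ultimately show False using safe_not_cwin by blast
qed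

end

section \<open>The subdivided dodecahedron\<close>

definition orient :: "int \<times> int \<Rightarrow> int \<times> int \<Rightarrow> int \<times> int \<Rightarrow> int" where
  "orient a b c = (fst b - fst a) * (snd c - snd a) - (fst c - fst a) * (snd b - snd a)"

text \<open>A sufficient condition for two segments to meet at most in a common first or a common second
  end point.\<close>

definition non_crossing :: "(int \<times> int) \<times> (int \<times> int) \<Rightarrow> (int \<times> int) \<times> (int \<times> int) \<Rightarrow> bool" where
  "non_crossing e e' \<longleftrightarrow> (case (e, e') of ((a, b), (c, d)) \<Rightarrow>
    if a = c then orient a b d \<noteq> 0 else if b = d then orient b a c \<noteq> 0
    else 0 < orient a b c \<and> 0 < orient a b d \<or> orient a b c < 0 \<and> orient a b d < 0 \<or>
      0 < orient c d a \<and> 0 < orient c d b \<or> orient c d a < 0 \<and> orient c d b < 0)"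

text \<open>Each row of six edges repeats one pattern with \<open>i\<close> modulo 5. The vertices 0
  to 4 form the outer pentagon and 15 to 19 the inner one; between them \<open>5 + i\<close> and
  \<open>10 + i\<close> alternate on a ring of ten, joined to \<open>i\<close> and
  \<open>15 + i\<close>.\<close>

definition dodecahedron :: "(nat \<times> nat) list" where
  "dodecahedron = [(0, 1), (0, 5), (5, 10), (10, 6), (10, 15), (15, 16), (1, 2), (1, 6), (6, 11),
    (11, 7), (11, 16), (16, 17), (2, 3), (2, 7), (7, 12), (12, 8), (12, 17), (17, 18), (3, 4), (3, 8),
    (8, 13), (13, 9), (13, 18), (18, 19), (4, 0), (4, 9), (9, 14), (14, 5), (14, 19), (19, 15)]"

text \<open>Vertices below 20 are those of the dodecahedron; \<open>20 + j\<close> subdivides its \<open>j\<close>-th edge. The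
  subdividing vertices are drawn slightly off the edges, so that adjacent segments are never
  collinear and the orientation test always applies.\<close>

definition half_edges :: "(nat \<times> nat) list" where
  "half_edges = map (\<lambda>j. (fst (dodecahedron ! j), 20 + j)) [0..<30] @
    map (\<lambda>j. (snd (dodecahedron ! j), 20 + j)) [0..<30]"

definition coordinates :: "(int \<times> int) list" where
  "coordinates = [(3, 9), (-8, 6), (-8, -6), (3, -10), (10, 0), (2, 7), (-6, 5), (-6, -5), (2, -8),
    (8, 0), (-2, 5), (-6, 0), (-2, -5), (5, -3), (5, 3), (-1, 3), (-3, 0), (-1, -3), (3, -2), (3, 2),
    (-2, 8), (2, 8), (-1, 6), (-4, 4), (-1, 4), (-2, 2), (-9, 0), (-7, 5), (-5, 2), (-7, -3), (-4, -1),
    (-2, -2), (-2, -8), (-7, -6), (-4, -6), (0, -7), (-2, -4), (1, -3), (7, -5), (3, -9), (4, -6),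
    (7, -2), (4, -2), (4, 0), (6, 5), (9, 1), (7, 2), (3, 5), (4, 3), (1, 2)]"

lemma distinct_coordinates: "distinct coordinates" "length coordinates = 50"
  by code_simp+

lemma half_edges_non_crossing:
  "sorted_wrt non_crossing (map (\<lambda>(u, m). (coordinates ! u, coordinates ! m)) half_edges)"
  by code_simp

text \<open>Adjacency before subdivision, in a form that can be evaluated.\<close>

definition nbs :: "nat \<Rightarrow> nat list" where
  "nbs u = map snd (filter (\<lambda>e. fst e = u) (dodecahedron @ map prod.swap dodecahedron))"

lemma dodecahedron_girth:
  "\<forall>u\<in>set [0..<20]. \<forall>v\<in>set (nbs u). \<forall>w\<in>set (nbs v). w \<notin> set (nbs u)"
  "\<forall>u\<in>set [0..<20]. \<forall>v\<in>set (nbs u). \<forall>w\<in>set (nbs u). v \<noteq> w \<longrightarrow> (\<forall>x\<in>set (nbs v). x \<in> set (nbs w) \<longrightarrow> x = u)"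
  by code_simp+

lemma dodecahedron_degree: "\<forall>u\<in>set [0..<20]. length (filter (\<lambda>e. fst e = u) half_edges) = 3"
  by code_simp

lemma dodecahedron_simple:
  "length dodecahedron = 30" "distinct (dodecahedron @ map prod.swap dodecahedron)" "distinct half_edges"
  "\<forall>e\<in>set dodecahedron. fst e < 20 \<and> snd e < 20 \<and> fst e \<noteq> snd e"
  by code_simp+

definition dodeca_vertices :: "nat set" where
  "dodeca_vertices = {..<50}"

definition dodeca_edge :: "nat \<Rightarrow> nat \<Rightarrow> bool" where
  "dodeca_edge u v \<longleftrightarrow> (u, v) \<in> set half_edges \<or> (v, u) \<in> set half_edges"

lemma half_edge_iff:
  "(u, m) \<in> set half_edges \<longleftrightarrow>
    (\<exists>j<30. m = 20 + j \<and> (u = fst (dodecahedron ! j) \<or> u = snd (dodecahedron ! j)))"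
  unfolding half_edges_def by (auto simp: image_iff)

lemma half_edge_bounds: "(u, m) \<in> set half_edges \<Longrightarrow> u < 20 \<and> 20 \<le> m \<and> m < 50"
  using dodecahedron_simple(1,4) nth_mem unfolding half_edge_iff by fastforce

lemma edge_branch: "dodeca_edge u m \<Longrightarrow> u < 20 \<Longrightarrow> (u, m) \<in> set half_edges"
  unfolding dodeca_edge_def using half_edge_bounds by fastforce

lemma edge_sym: "dodeca_edge u v \<Longrightarrow> dodeca_edge v u"
  unfolding dodeca_edge_def by blast

lemma edge_bip: "dodeca_edge u v \<Longrightarrow> u < 20 \<longleftrightarrow> \<not> v < 20"
  unfolding dodeca_edge_def using half_edge_bounds by fastforce

lemma graph_edge: "graph dodeca_vertices dodeca_edge"
  unfolding graph_def dodeca_vertices_def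
proof (intro conjI allI impI)
  fix u v assume "dodeca_edge u v"
  then show "u \<in> {..<50}" "v \<in> {..<50}" "dodeca_edge v u" unfolding dodeca_edge_def using half_edge_bounds by fastforce+
next
  show "\<not> dodeca_edge u u" for u using edge_bip by blast
  show "{..<50::nat} \<noteq> {}" by (auto simp: lessThan_empty_iff)
qed auto

lemma edge_link:
  assumes "dodeca_edge u m" "dodeca_edge m w" "u < 20" "u \<noteq> w"
  shows "\<exists>j<30. m = 20 + j \<and> (dodecahedron ! j = (u, w) \<or> dodecahedron ! j = (w, u))"
proof -
  have "\<not> m < 20" "w < 20" using assms edge_bip by blast+
  then have "(u, m) \<in> set half_edges" "(w, m) \<in> set half_edges"
    using edge_branch assms edge_sym by blast+
  then show ?thesis unfolding half_edge_iff using assms(4) by (auto simp: prod_eq_iff)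
qed

lemma edge_link_nbs:
  assumes "dodeca_edge u m" "dodeca_edge m w" "u < 20" "u \<noteq> w"
  shows "w \<in> set (nbs u)"
proof -
  obtain j where "j < 30" "dodecahedron ! j = (u, w) \<or> dodecahedron ! j = (w, u)"
    using edge_link[OF assms] by blast
  then have "(u, w) \<in> set dodecahedron \<or> (w, u) \<in> set dodecahedron"
    using dodecahedron_simple(1) nth_mem by metis
  then show ?thesis unfolding nbs_def by force
qed

lemma dodecahedron_index_unique:
  assumes "i < 30" "j < 30" "dodecahedron ! i = (u, w) \<or> dodecahedron ! i = (w, u)"
    "dodecahedron ! j = (u, w) \<or> dodecahedron ! j = (w, u)"
  shows "i = j"
proof -
  have d: "distinct dodecahedron" "set dodecahedron \<inter> prod.swap ` set dodecahedron = {}"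
    using dodecahedron_simple(2) by auto
  have mem: "dodecahedron ! i \<in> set dodecahedron" "dodecahedron ! j \<in> set dodecahedron"
    using assms dodecahedron_simple(1) by auto
  have "dodecahedron ! i \<noteq> prod.swap (dodecahedron ! j)" using mem d(2) by blast
  then have "dodecahedron ! i = dodecahedron ! j" using assms(3,4) by auto
  then show ?thesis using nth_eq_iff_index_eq[OF d(1)] assms(1,2) dodecahedron_simple(1) by simp
qed

interpretation dodecahedron: subdivision dodeca_vertices "{..<20}" dodeca_edge
proof
  show "graph dodeca_vertices dodeca_edge" by (rule graph_edge)
  show "{..<20} \<subseteq> dodeca_vertices" unfolding dodeca_vertices_def by auto
  show "7 \<le> card {..<20::nat}" by simp
  show "u \<in> {..<20} \<longleftrightarrow> v \<notin> {..<20}" if "dodeca_edge u v" for u v using edge_bip[OF that] by simp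
  show "\<exists>u w. u \<noteq> w \<and> {v. dodeca_edge m v} = {u, w}" if m: "m \<in> dodeca_vertices - {..<20}" for m
  proof -
    obtain j where j: "m = 20 + j" using m le_Suc_ex[of 20 m] by auto
    then have "j < 30" using m unfolding dodeca_vertices_def by simp
    have "dodeca_edge m v \<longleftrightarrow> (v, m) \<in> set half_edges" for v
      unfolding dodeca_edge_def using half_edge_bounds[of m v] m by auto
    then have "{v. dodeca_edge m v} = {fst (dodecahedron ! j), snd (dodecahedron ! j)}"
      using j \<open>j < 30\<close> unfolding half_edge_iff by auto
    moreover have "dodecahedron ! j \<in> set dodecahedron" using \<open>j < 30\<close> dodecahedron_simple(1) by simp
    ultimately show ?thesis using dodecahedron_simple(4) by blast
  qed
  show "\<exists>m1 m2. dodeca_edge u m1 \<and> dodeca_edge u m2 \<and> m1 \<noteq> m2 \<and> m1 \<noteq> m \<and> m2 \<noteq> m" if u: "u \<in> {..<20}" for u m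
  proof -
    let ?L = "filter (\<lambda>e. fst e = u) half_edges"
    have "distinct ?L" "length ?L = 3" using dodecahedron_simple(3) dodecahedron_degree u by auto
    then have "card (set ?L) = 3" by (metis distinct_card)
    then have "1 < card (set ?L - {(u, m)})"
      using card_Diff_singleton_if[of "set ?L" "(u, m)"] by auto
    then obtain e1 e2 where e: "e1 \<in> set ?L - {(u, m)}" "e2 \<in> set ?L - {(u, m)}" "e1 \<noteq> e2"
      using card_le_Suc0_iff_eq[of "set ?L - {(u, m)}"] by auto
    show ?thesis
      by (intro exI[of _ "snd e1"] exI[of _ "snd e2"])
        (use e in \<open>cases e1; cases e2; auto simp: dodeca_edge_def\<close>)
  qed
  show "m = m'" if "dodeca_edge u m" "dodeca_edge m w" "dodeca_edge u m'" "dodeca_edge m' w" "u \<in> {..<20}" "u \<noteq> w" for u m w m'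
    using edge_link[of u m w] edge_link[of u m' w] that dodecahedron_index_unique[of _ _ u w] by auto
  show False if a: "dodeca_edge u m1" "dodeca_edge m1 v" "dodeca_edge v m2" "dodeca_edge m2 w" "dodeca_edge w m3" "dodeca_edge m3 u" "u \<in> {..<20}"
    "u \<noteq> v" "v \<noteq> w" "w \<noteq> u" for u m1 v m2 w m3
  proof -
    have v: "v < 20" using a edge_bip[of u m1] edge_bip[of m1 v] by auto
    have "v \<in> set (nbs u)" "w \<in> set (nbs v)" "w \<in> set (nbs u)"
      using edge_link_nbs a v edge_sym by (metis lessThan_iff)+
    then show False using dodecahedron_girth(1) a(7) by auto
  qed
  show False if a: "dodeca_edge u m1" "dodeca_edge m1 v" "dodeca_edge v m2" "dodeca_edge m2 x" "dodeca_edge x m3" "dodeca_edge m3 w" "dodeca_edge w m4" "dodeca_edge m4 u"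
    "u \<in> {..<20}" "u \<noteq> v" "v \<noteq> x" "x \<noteq> w" "w \<noteq> u" "u \<noteq> x" "v \<noteq> w" for u m1 v m2 x m3 w m4
  proof -
    have v: "v < 20" "w < 20"
      using a(1,2,7-9) edge_bip[of u m1] edge_bip[of m1 v] edge_bip[of w m4] edge_bip[of m4 u] by auto
    have "v \<in> set (nbs u)" "w \<in> set (nbs u)" "x \<in> set (nbs v)" "x \<in> set (nbs w)"
      using edge_link_nbs a v edge_sym by (metis lessThan_iff)+
    moreover have "u \<in> set [0..<20]" using a(9) by simp
    ultimately have "x = u" using dodecahedron_girth(2)[rule_format, of u v w x] a(15) by simp
    then show False using a(14) by simp
  qed
qed

text \<open>A certificate of connectedness: descending through smaller neighbours leads to vertex
  0.\<close>

lemma dodecahedron_spanning: "\<forall>v\<in>set [1..<20]. \<exists>u\<in>set (nbs v). u < v"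
  by code_simp

lemma nbs_link: "w \<in> set (nbs u) \<Longrightarrow> \<exists>m. dodeca_edge u m \<and> dodeca_edge m w"
proof -
  assume "w \<in> set (nbs u)"
  then have "(u, w) \<in> set dodecahedron \<or> (w, u) \<in> set dodecahedron" unfolding nbs_def by auto
  then obtain j where "j < 30" "dodecahedron ! j = (u, w) \<or> dodecahedron ! j = (w, u)"
    using dodecahedron_simple(1) by (metis in_set_conv_nth)
  then have "(u, 20 + j) \<in> set half_edges" "(w, 20 + j) \<in> set half_edges"
    unfolding half_edge_iff by auto
  then show ?thesis unfolding dodeca_edge_def by blast
qed

lemma connected_dodecahedron: "connected_graph dodeca_vertices dodeca_edge"
proof -
  have branch: "dodeca_edge\<^sup>*\<^sup>* 0 v" if "v < 20" for v
    using that
  proof (induction v rule: less_induct)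
    case (less v)
    show ?case
    proof (cases "v = 0")
      case False
      then have "v \<in> set [1..<20]" using less.prems by simp
      then obtain u where u: "u \<in> set (nbs v)" "u < v" using dodecahedron_spanning by blast
      then obtain m where "dodeca_edge v m" "dodeca_edge m u" using nbs_link by blast
      moreover have "dodeca_edge\<^sup>*\<^sup>* 0 u" using less u by simp
      ultimately show ?thesis using edge_sym by (meson rtranclp.rtrancl_into_rtrancl)
    qed simp
  qed
  have reach: "dodeca_edge\<^sup>*\<^sup>* 0 v" if v: "v \<in> dodeca_vertices" for v
  proof (cases "v < 20")
    case False
    then obtain u where "dodeca_edge v u" using dodecahedron.two_ends[of v] v by blast
    moreover have "u < 20" using edge_bip[OF \<open>dodeca_edge v u\<close>] False by blast
    ultimately show ?thesis using branch edge_sym by (meson rtranclp.rtrancl_into_rtrancl)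
  qed (rule branch)
  have "symp dodeca_edge\<^sup>*\<^sup>*" by (rule symp_rtranclp) (auto intro: sympI edge_sym)
  then show ?thesis
    unfolding connected_graph_def using reach by (meson sympD rtranclp_trans)
qed

section \<open>Straight-line drawing and the orientation test\<close>

definition point :: "nat \<Rightarrow> complex" where
  "point v = Complex (of_int (fst (coordinates ! v))) (of_int (snd (coordinates ! v)))"

text \<open>Twice the signed area of a triangle. It is affine in the third point, so its signs at
  two ends decide a whole segment.\<close>

definition orientation :: "complex \<Rightarrow> complex \<Rightarrow> complex \<Rightarrow> real" where
  "orientation a b c = (Re b - Re a) * (Im c - Im a) - (Re c - Re a) * (Im b - Im a)"

lemma orientation_segment:
  "orientation a b ((1 - t) *\<^sub>R c + t *\<^sub>R d) = (1 - t) * orientation a b c + t * orientation a b d"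
  unfolding orientation_def by (simp add: algebra_simps)

lemma orientation_on_segment: "z \<in> closed_segment a b \<Longrightarrow> orientation a b z = 0"
  unfolding in_segment by (auto simp: orientation_segment) (simp add: orientation_def)

lemma segments_disjoint:
  assumes "0 < orientation a b c \<and> 0 < orientation a b d \<or> orientation a b c < 0 \<and> orientation a b d < 0"
  shows "closed_segment a b \<inter> closed_segment c d = {}"
proof -
  have False if z: "z \<in> closed_segment a b" "z \<in> closed_segment c d" for z
  proof -
    obtain t where t: "0 \<le> t" "t \<le> 1" "z = (1 - t) *\<^sub>R c + t *\<^sub>R d" using z(2) unfolding in_segment by blast
    let ?x = "orientation a b c" and ?y = "orientation a b d"
    have eq: "(1 - t) * ?x + t * ?y = 0"
      using orientation_on_segment[OF z(1)] t(3) orientation_segment by metis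
    from assms show False
    proof
      assume "0 < ?x \<and> 0 < ?y"
      then have "0 < (1 - t) * ?x + t * ?y"
        using t by (cases "t = 0") (auto intro!: add_nonneg_pos)
      then show False using eq by simp
    next
      assume *: "?x < 0 \<and> ?y < 0"
      then have "(1 - t) * ?x + t * ?y < 0"
        using t by (cases "t = 0") (auto intro!: add_nonpos_neg mult_nonneg_nonpos mult_pos_neg)
      then show False using eq by simp
    qed
  qed
  then show ?thesis by blast
qed

lemma segments_meet_in_end:
  assumes "orientation a b d \<noteq> 0"
  shows "closed_segment a b \<inter> closed_segment a d \<subseteq> {a}"
proof
  fix z assume z: "z \<in> closed_segment a b \<inter> closed_segment a d"
  then have "z \<in> closed_segment a d" by blast
  then obtain t where t: "z = (1 - t) *\<^sub>R a + t *\<^sub>R d" unfolding in_segment by blast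
  have "orientation a b a = 0" by (simp add: orientation_def)
  then have "t * orientation a b d = 0"
    using orientation_on_segment[of z a b] z t orientation_segment[of a b t a d] by simp
  then show "z \<in> {a}" using assms t by simp
qed

lemma orientation_point:
  "orientation (point u) (point v) (point w) = of_int (orient (coordinates ! u) (coordinates ! v) (coordinates ! w))"
  unfolding orientation_def point_def orient_def by simp

lemma coordinates_inj: "u < 50 \<Longrightarrow> v < 50 \<Longrightarrow> coordinates ! u = coordinates ! v \<longleftrightarrow> u = v"
  using distinct_coordinates by (simp add: nth_eq_iff_index_eq)

lemma point_inj: "u < 50 \<Longrightarrow> v < 50 \<Longrightarrow> point u = point v \<longleftrightarrow> u = v"
  unfolding point_def using coordinates_inj by (auto simp: prod_eq_iff)

text \<open>Half edges run from an original vertex to a subdividing one, so two of them can share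
  only first ends or only second ends, the cases that the test distinguishes.\<close>

lemma non_crossing_segments:
  assumes e: "(u, m) \<in> set half_edges" "(w, n) \<in> set half_edges" "(u, m) \<noteq> (w, n)"
    and nc: "non_crossing (coordinates ! u, coordinates ! m) (coordinates ! w, coordinates ! n)"
  shows "closed_segment (point u) (point m) \<inter> closed_segment (point w) (point n) \<subseteq> point ` ({u, m} \<inter> {w, n})"
proof -
  have lt: "u < 50" "m < 50" "w < 50" "n < 50" using e half_edge_bounds by fastforce+
  note nc' = nc[unfolded non_crossing_def prod.case coordinates_inj[OF lt(1,3)] coordinates_inj[OF lt(2,4)]]
  consider "u = w" | "u \<noteq> w" "m = n" | "u \<noteq> w" "m \<noteq> n" by blast
  then show ?thesis
  proof cases
    case 1
    then have "orientation (point u) (point m) (point n) \<noteq> 0" using nc' by (simp add: orientation_point)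
    then show ?thesis using segments_meet_in_end 1 by blast
  next
    case 2
    then have "orientation (point m) (point u) (point w) \<noteq> 0" using nc' by (simp add: orientation_point)
    then show ?thesis using segments_meet_in_end[of "point m" "point u" "point w"] 2
      by (auto simp: closed_segment_commute)
  next
    case 3
    then have "closed_segment (point u) (point m) \<inter> closed_segment (point w) (point n) = {}"
      using nc' segments_disjoint[of "point u" "point m" "point w" "point n"]
        segments_disjoint[of "point w" "point n" "point u" "point m"]
      by (auto simp: orientation_point)
    then show ?thesis by blast
  qed
qed

lemma sorted_wrt_pair:
  "sorted_wrt P xs \<Longrightarrow> x \<in> set xs \<Longrightarrow> y \<in> set xs \<Longrightarrow> x \<noteq> y \<Longrightarrow> P x y \<or> P y x"
  by (induction xs) auto

lemma half_edge_segments: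
  assumes e: "(u, m) \<in> set half_edges" "(w, n) \<in> set half_edges" "(u, m) \<noteq> (w, n)"
  shows "closed_segment (point u) (point m) \<inter> closed_segment (point w) (point n) \<subseteq> point ` ({u, m} \<inter> {w, n})"
proof -
  let ?P = "\<lambda>e e'. non_crossing (coordinates ! fst e, coordinates ! snd e) (coordinates ! fst e', coordinates ! snd e')"
  have "sorted_wrt ?P half_edges"
    using half_edges_non_crossing by (simp add: sorted_wrt_map case_prod_beta)
  from sorted_wrt_pair[OF this e] show ?thesis
    using non_crossing_segments[OF e] non_crossing_segments[OF e(2,1)] e(3) by (auto simp: Int_commute)
qed

lemma edge_segments:
  assumes "dodeca_edge u v" "dodeca_edge x y" "{u, v} \<noteq> {x, y}"
  shows "closed_segment (point u) (point v) \<inter> closed_segment (point x) (point y) \<subseteq> point ` ({u, v} \<inter> {x, y})"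
proof -
  have "\<exists>a b. (a, b) \<in> set half_edges \<and> {a, b} = {u, v} \<and>
      closed_segment (point u) (point v) = closed_segment (point a) (point b)" if "dodeca_edge u v" for u v
    using that unfolding dodeca_edge_def by (metis closed_segment_commute insert_commute)
  then obtain a b c d where h: "(a, b) \<in> set half_edges" "{a, b} = {u, v}"
      "closed_segment (point u) (point v) = closed_segment (point a) (point b)"
      "(c, d) \<in> set half_edges" "{c, d} = {x, y}"
      "closed_segment (point x) (point y) = closed_segment (point c) (point d)"
    using assms(1,2) by metis
  then have "(a, b) \<noteq> (c, d)" using assms(3) by blast
  from half_edge_segments[OF h(1,4) this] show ?thesis unfolding h(2,3,5,6) .
qed

lemma planar_dodecahedron: "planar dodeca_vertices dodeca_edge"
  unfolding planar_def
proof (intro exI conjI allI impI)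
  \<comment> \<open>Edges are named by unordered pairs; \<open>Min\<close> and \<open>Max\<close>
    choose a direction.\<close>
  let ?g = "\<lambda>S. linepath (point (Min S)) (point (Max S))"
  have im: "path_image (?g {u, v}) = closed_segment (point u) (point v)" for u v
    by (cases "u \<le> v") (auto simp: min_def max_def closed_segment_commute)
  have V: "u < 50" "v < 50" "u \<noteq> v" if "dodeca_edge u v" for u v
    using graph_edge that unfolding graph_def dodeca_vertices_def by auto
  show "inj_on point dodeca_vertices" unfolding dodeca_vertices_def by (auto intro!: inj_onI simp: point_inj)
  fix u v assume uv: "dodeca_edge u v"
  show "arc (?g {u, v})" using V[OF uv] point_inj by (auto simp: min_def max_def)
  show "{pathstart (?g {u, v}), pathfinish (?g {u, v})} = {point u, point v}"
    by (auto simp: min_def max_def)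
  show "\<forall>w\<in>dodeca_vertices - {u, v}. point w \<notin> path_image (?g {u, v})"
  proof
    fix w assume w: "w \<in> dodeca_vertices - {u, v}"
    \<comment> \<open>Every vertex lies on some edge, so avoidance of vertices follows from that of
      edges.\<close>
    obtain x where wx: "dodeca_edge w x"
      using dodecahedron.degree[of w] dodecahedron.two_ends[of w] w by blast
    then have "{w, x} \<noteq> {u, v}" using w by blast
    then have "closed_segment (point w) (point x) \<inter> closed_segment (point u) (point v) \<subseteq> point ` ({w, x} \<inter> {u, v})"
      using edge_segments wx uv by blast
    moreover have "point w \<notin> point ` {u, v}" using w V[OF uv] V[OF wx] point_inj by auto
    ultimately show "point w \<notin> path_image (?g {u, v})" unfolding im by auto
  qed
  fix x y assume "dodeca_edge x y" "{u, v} \<noteq> {x, y}"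
  then show "path_image (?g {u, v}) \<inter> path_image (?g {x, y}) \<subseteq> point ` ({u, v} \<inter> {x, y})"
    unfolding im using edge_segments uv by blast
qed

lemma bipartite_dodecahedron: "bipartite dodeca_vertices dodeca_edge"
  unfolding bipartite_def dodeca_vertices_def
  by (intro exI[of _ "{..<20}"]) (use edge_bip in auto)

section \<open>The upper bound and its sharpness\<close>

lemma planar_bipartite_four_cops_win:
  assumes "graph V E" "connected_graph V E" "bipartite V E" "planar V E"
  shows "cops_win V E 4"
proof -
  obtain A where "\<forall>u v. E u v \<longrightarrow> (u \<in> A \<longleftrightarrow> v \<notin> A)" using assms(3) unfolding bipartite_def by blast
  then interpret two_coloured_graph V E A using assms by unfold_locales auto
  show ?thesis by (rule four_cops_win[OF assms(4)])
qed

theorem theorem5: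
  shows "(\<forall>(V :: 'a set) E. graph V E \<and> connected_graph V E \<and> bipartite V E \<and> planar V E
            \<longrightarrow> attacking_cop_number V E \<le> 4) \<and>
         (\<exists>(V :: nat set) E. graph V E \<and> connected_graph V E \<and> bipartite V E \<and> planar V E \<and>
            attacking_cop_number V E = 4)"
proof (intro conjI allI impI)
  fix V :: "'a set" and E
  assume "graph V E \<and> connected_graph V E \<and> bipartite V E \<and> planar V E"
  then have "cops_win V E 4" using planar_bipartite_four_cops_win by blast
  then show "attacking_cop_number V E \<le> 4" unfolding attacking_cop_number_def by (rule Least_le)
next
  note H = graph_edge connected_dodecahedron bipartite_dodecahedron planar_dodecahedron
  have "attacking_cop_number dodeca_vertices dodeca_edge = 4"
    unfolding attacking_cop_number_def
  proof (rule Least_equality)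
    show "cops_win dodeca_vertices dodeca_edge 4" by (rule planar_bipartite_four_cops_win[OF H])
    fix k assume "cops_win dodeca_vertices dodeca_edge k"
    then show "4 \<le> k" using dodecahedron.three_cops_lose[of k] by linarith
  qed
  then show "\<exists>(V :: nat set) E. graph V E \<and> connected_graph V E \<and> bipartite V E \<and> planar V E \<and>
      attacking_cop_number V E = 4"
    using H by blast
qed

end
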